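(* Let $\Gamma$ be a right-angled Coxeter group with generating set $S$ whose defining diagram is super-flexible, and let $I_0\subset\mathbb R$ be a closed interval. Let $P=\lambda(\mathbf 1_S)=\sum_{s\in S}\lambda(s)$ and $R^z=(P-z\,\mathrm{Id})^{-1}$. If there is a constant $C_0$ such that $(\Im R^{E+i\eta})(e,e)\le C_0$ for all $E\in I_0$ and $\eta>0$, then for some $C_1'>2C_1+1$, $$\lim_{\eta\to0}\ \sup_{\lambda_0\in I_0}\ \sum_{g\in\Gamma}\eta^2\,|(\Im R^{\lambda_0+i\eta})(e,g)|^4\,|g|^{C_1'}=0 ,$$ where $C_1$ is a rapid decay exponent of $\Gamma$.
   Context: A right-angled Coxeter group is a group $\Gamma=\langle s_1,\dots,s_n\mid(s_is_j)^{m_{ij}}\rangle$ with $m_{ij}=m_{ji}\in\{1,2,+\infty\}$, $m_{ii}=1$, and $m_{ij}\ge2$ for $i\ne j$, where $(s_is_j)^{+\infty}$ means that no relation between $s_i$ and $s_j$ is imposed (so with the convention that $m_{ii}=1$ encodes $s_i^2=e$, and $m_{ij}=2$ encodes $s_is_j=s_js_i$). $S=\{s_1,\dots,s_n\}$. Its defining diagram is the graph with vertex set $S$ and an edge between distinct $s_i,s_j$ if and only if $m_{ij}=2$ (then $s_i$ and $s_j$ are called neighbors). The defining diagram is super-flexible if for any $s,t\in S$ which do not commute there exist $u\in S\setminus\{s,t\}$ commuting with neither $s$ nor $t$, and a graph automorphism $\phi$ of the defining diagram such that either (i) $\phi$ fixes $s$, fixes all neighbors of $s$, and exchanges $t$ and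 $u$; or (ii) $\phi$ fixes $t$, fixes all neighbors of $t$, and exchanges $s$ and $u$. $\lambda$ is the left regular representation on $\ell^2(\Gamma)$, $\lambda(g)\delta_v=\delta_{gv}$; $e$ is the unit; $\Im R=(R-R^* )/(2i)$; $Q(g,h)=\langle\delta_g,Q\delta_h\rangle$; $|g|$ is the word length with respect to a fixed finite generating set. A rapid decay exponent of $\Gamma$ is a constant $C_1>0$ for which there are $C>0$ and a finite generating set $S'$ such that $\|\sum_gq_g\lambda(g)\|_{\rm op}\le C(\mathrm{diam}_{S'}(q))^{C_1}(\sum_g|q_g|^2)^{1/2}$ for all finitely supported $q:\Gamma\to\mathbb C$, where $\mathrm{diam}_{S'}(q)$ is the maximum of $1$ and the diameter of the support of $q$ in $\mathrm{Cay}(\Gamma,S')$ (edges from $g$ to $sg$, $s\in S'$). Such a constant exists for every right-angled Coxeter group (known fact). *)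

theory Defs
  imports "HOL-Analysis.Analysis" "HOL-Algebra.Generated_Groups" "HOL-Library.Extended_Nat"
begin

section \<open>Group presentations and right-angled Coxeter groups\<close>

text \<open>A letter is a generator together with a sign; \<^term>\<open>(s, False)\<close> stands for the formal
  inverse of \<^term>\<open>s\<close>. The words over \<^term>\<open>S\<close> are the elements of \<open>lists (S \<times> UNIV)\<close>.\<close>

type_synonym 'a gword = "('a \<times> bool) list"

text \<open>Equality of words in the group with generators \<open>S\<close> and relators \<open>R\<close>: words over \<open>S\<close>
  modulo the congruence generated by free cancellation and deletion of relators.\<close>

inductive presentation_eq :: "'a set \<Rightarrow> 'a gword set \<Rightarrow> 'a gword \<Rightarrow> 'a gword \<Rightarrow> bool"
  for S :: "'a set" and R :: "'a gword set" where
  refl: "w \<in> lists (S \<times> UNIV) \<Longrightarrow> presentation_eq S R w w"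
| sym: "presentation_eq S R v w \<Longrightarrow> presentation_eq S R w v"
| trans: "presentation_eq S R u v \<Longrightarrow> presentation_eq S R v w \<Longrightarrow> presentation_eq S R u w"
| cancel: "u \<in> lists (S \<times> UNIV) \<Longrightarrow> v \<in> lists (S \<times> UNIV) \<Longrightarrow> s \<in> S \<Longrightarrow>
    presentation_eq S R (u @ [(s, b), (s, \<not> b)] @ v) (u @ v)"
| relator: "u \<in> lists (S \<times> UNIV) \<Longrightarrow> v \<in> lists (S \<times> UNIV) \<Longrightarrow> r \<in> R \<Longrightarrow>
    presentation_eq S R (u @ r @ v) (u @ v)"

definition eval_word :: "('a, 'b) monoid_scheme \<Rightarrow> 'a gword \<Rightarrow> 'a" where
  "eval_word G w = foldr (\<lambda>(s, b) x. (if b then s else inv\<^bsub>G\<^esub> s) \<otimes>\<^bsub>G\<^esub> x) w \<one>\<^bsub>G\<^esub>"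

text \<open>\<open>G = \<langle>S | R\<rangle>\<close>: the evaluation of words induces a bijection (hence an isomorphism) from the
  group of words over \<open>S\<close> modulo \<^const>\<open>presentation_eq\<close> onto \<open>G\<close>.\<close>

definition has_presentation :: "('a, 'b) monoid_scheme \<Rightarrow> 'a set \<Rightarrow> 'a gword set \<Rightarrow> bool" where
  "has_presentation G S R \<longleftrightarrow>
     group G \<and> S \<subseteq> carrier G \<and>
     eval_word G ` lists (S \<times> UNIV) = carrier G \<and>
     (\<forall>v \<in> lists (S \<times> UNIV). \<forall>w \<in> lists (S \<times> UNIV).
        eval_word G v = eval_word G w \<longleftrightarrow> presentation_eq S R v w)"

definition right_angled_coxeter_matrix :: "'a set \<Rightarrow> ('a \<Rightarrow> 'a \<Rightarrow> enat) \<Rightarrow> bool" where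
  "right_angled_coxeter_matrix S m \<longleftrightarrow>
     (\<forall>s \<in> S. m s s = 1) \<and>
     (\<forall>s \<in> S. \<forall>t \<in> S. m s t = m t s \<and> m s t \<in> {1, 2, \<infinity>} \<and> (s \<noteq> t \<longrightarrow> m s t \<ge> 2))"

text \<open>The words \<open>(s t)\<^bsup>m s t\<^esup>\<close>; an infinite entry of \<open>m\<close> contributes no relator.\<close>

definition coxeter_relators :: "'a set \<Rightarrow> ('a \<Rightarrow> 'a \<Rightarrow> enat) \<Rightarrow> 'a gword set" where
  "coxeter_relators S m =
     {concat (replicate k [(s, True), (t, True)]) | s t k. s \<in> S \<and> t \<in> S \<and> m s t = enat k}"

definition right_angled_coxeter_group ::
    "('a, 'b) monoid_scheme \<Rightarrow> 'a set \<Rightarrow> ('a \<Rightarrow> 'a \<Rightarrow> enat) \<Rightarrow> bool" where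
  "right_angled_coxeter_group G S m \<longleftrightarrow>
     finite S \<and> right_angled_coxeter_matrix S m \<and> has_presentation G S (coxeter_relators S m)"

subsection \<open>Super-flexible defining diagrams\<close>

definition neighbors :: "'a set \<Rightarrow> ('a \<Rightarrow> 'a \<Rightarrow> enat) \<Rightarrow> 'a \<Rightarrow> 'a set" where
  "neighbors S m s = {t \<in> S. t \<noteq> s \<and> m s t = 2}"

definition diagram_automorphism :: "'a set \<Rightarrow> ('a \<Rightarrow> 'a \<Rightarrow> enat) \<Rightarrow> ('a \<Rightarrow> 'a) \<Rightarrow> bool" where
  "diagram_automorphism S m \<phi> \<longleftrightarrow>
     bij_betw \<phi> S S \<and>
     (\<forall>s \<in> S. \<forall>t \<in> S. t \<in> neighbors S m s \<longleftrightarrow> \<phi> t \<in> neighbors S m (\<phi> s))"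

definition commuting :: "('a, 'b) monoid_scheme \<Rightarrow> 'a \<Rightarrow> 'a \<Rightarrow> bool" where
  "commuting G s t \<longleftrightarrow> s \<otimes>\<^bsub>G\<^esub> t = t \<otimes>\<^bsub>G\<^esub> s"

definition super_flexible ::
    "('a, 'b) monoid_scheme \<Rightarrow> 'a set \<Rightarrow> ('a \<Rightarrow> 'a \<Rightarrow> enat) \<Rightarrow> bool" where
  "super_flexible G S m \<longleftrightarrow>
     (\<forall>s \<in> S. \<forall>t \<in> S. \<not> commuting G s t \<longrightarrow>
       (\<exists>u \<in> S - {s, t}. \<not> commuting G u s \<and> \<not> commuting G u t \<and>
         (\<exists>\<phi>. diagram_automorphism S m \<phi> \<and>
           ((\<phi> s = s \<and> (\<forall>v \<in> neighbors S m s. \<phi> v = v) \<and> \<phi> t = u \<and> \<phi> u = t) \<or>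
            (\<phi> t = t \<and> (\<forall>v \<in> neighbors S m t. \<phi> v = v) \<and> \<phi> s = u \<and> \<phi> u = s)))))"

section \<open>Word length and distance in Cayley graphs\<close>

definition finite_generating_set :: "('a, 'b) monoid_scheme \<Rightarrow> 'a set \<Rightarrow> bool" where
  "finite_generating_set G T \<longleftrightarrow> finite T \<and> T \<subseteq> carrier G \<and> generate G T = carrier G"

definition word_length :: "('a, 'b) monoid_scheme \<Rightarrow> 'a set \<Rightarrow> 'a \<Rightarrow> nat" where
  "word_length G T g = (LEAST n. \<exists>w \<in> lists (T \<times> UNIV). length w = n \<and> eval_word G w = g)"

text \<open>The edges from \<open>g\<close> to \<open>s g\<close>, made undirected.\<close>

definition cayley_edges :: "('a, 'b) monoid_scheme \<Rightarrow> 'a set \<Rightarrow> ('a \<times> 'a) set" where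
  "cayley_edges G T =
     (let E = {(g, s \<otimes>\<^bsub>G\<^esub> g) | s g. s \<in> T \<and> g \<in> carrier G} in E \<union> E\<inverse>)"

definition cayley_dist :: "('a, 'b) monoid_scheme \<Rightarrow> 'a set \<Rightarrow> 'a \<Rightarrow> 'a \<Rightarrow> nat" where
  "cayley_dist G T g h = (LEAST n. (g, h) \<in> cayley_edges G T ^^ n)"

definition supp_diam :: "('a, 'b) monoid_scheme \<Rightarrow> 'a set \<Rightarrow> ('a \<Rightarrow> complex) \<Rightarrow> nat" where
  "supp_diam G T q = Max (insert 1 {cayley_dist G T g h | g h. q g \<noteq> 0 \<and> q h \<noteq> 0})"

section \<open>The Hilbert space \<open>\<ell>\<^sup>2(X)\<close> and operators on it\<close>

text \<open>Elements of \<open>\<ell>\<^sup>2(X)\<close> are functions on the whole type that vanish outside \<open>X\<close>. Operators are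
  functions on functions; only their values on \<open>\<ell>\<^sup>2(X)\<close> matter.\<close>

definition ell2 :: "'a set \<Rightarrow> ('a \<Rightarrow> complex) set" where
  "ell2 X = {f. (\<forall>x. x \<notin> X \<longrightarrow> f x = 0) \<and> (\<lambda>x. (cmod (f x))\<^sup>2) summable_on X}"

text \<open>The inner product is linear in the second argument.\<close>

definition ell2_inner :: "'a set \<Rightarrow> ('a \<Rightarrow> complex) \<Rightarrow> ('a \<Rightarrow> complex) \<Rightarrow> complex" where
  "ell2_inner X f h = (\<Sum>\<^sub>\<infinity>x\<in>X. cnj (f x) * h x)"

definition ell2_norm :: "'a set \<Rightarrow> ('a \<Rightarrow> complex) \<Rightarrow> real" where
  "ell2_norm X f = sqrt (\<Sum>\<^sub>\<infinity>x\<in>X. (cmod (f x))\<^sup>2)"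

definition delta :: "'a \<Rightarrow> 'a \<Rightarrow> complex" where
  "delta g = (\<lambda>x. if x = g then 1 else 0)"

type_synonym 'a oper = "('a \<Rightarrow> complex) \<Rightarrow> ('a \<Rightarrow> complex)"

text \<open>The operator norm, meant for operators that are bounded on \<open>\<ell>\<^sup>2(X)\<close>.\<close>

definition op_norm :: "'a set \<Rightarrow> 'a oper \<Rightarrow> real" where
  "op_norm X Q = (SUP f \<in> {f \<in> ell2 X. ell2_norm X f \<le> 1}. ell2_norm X (Q f))"

definition adjoint_op :: "'a set \<Rightarrow> 'a oper \<Rightarrow> 'a oper" where
  "adjoint_op X Q f =
     (THE h. h \<in> ell2 X \<and> (\<forall>k \<in> ell2 X. ell2_inner X h k = ell2_inner X f (Q k)))"

definition Im_op :: "'a set \<Rightarrow> 'a oper \<Rightarrow> 'a oper" where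
  "Im_op X Q f = (\<lambda>x. (Q f x - adjoint_op X Q f x) / (2 * \<i>))"

definition op_kernel :: "'a set \<Rightarrow> 'a oper \<Rightarrow> 'a \<Rightarrow> 'a \<Rightarrow> complex" where
  "op_kernel X Q g h = ell2_inner X (delta g) (Q (delta h))"

text \<open>\<open>(Q - z Id)\<^sup>-\<^sup>1\<close>, meant for \<open>z\<close> outside the spectrum of \<open>Q\<close>, where \<open>Q - z Id\<close> is a bijection
  of \<open>\<ell>\<^sup>2(X)\<close>.\<close>

definition resolvent_op :: "'a set \<Rightarrow> 'a oper \<Rightarrow> complex \<Rightarrow> 'a oper" where
  "resolvent_op X Q z = the_inv_into (ell2 X) (\<lambda>f x. Q f x - z * f x)"

section \<open>The left regular representation and rapid decay\<close>

definition left_regular :: "('a, 'b) monoid_scheme \<Rightarrow> 'a \<Rightarrow> 'a oper" where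
  "left_regular G g f = (\<lambda>x. if x \<in> carrier G then f (inv\<^bsub>G\<^esub> g \<otimes>\<^bsub>G\<^esub> x) else 0)"

lemma left_regular_delta:
  assumes "group G" "g \<in> carrier G" "v \<in> carrier G"
  shows "left_regular G g (delta v) = delta (g \<otimes>\<^bsub>G\<^esub> v)"
proof -
  interpret group G by fact
  show ?thesis
    using assms(2,3) by (auto simp: left_regular_def delta_def fun_eq_iff m_assoc[symmetric])
qed

text \<open>\<open>\<lambda>(q) = \<Sum>\<^sub>g q\<^sub>g \<lambda>(g)\<close> for finitely supported \<open>q\<close>.\<close>

definition left_regular_fun :: "('a, 'b) monoid_scheme \<Rightarrow> ('a \<Rightarrow> complex) \<Rightarrow> 'a oper" where
  "left_regular_fun G q f = (\<lambda>x. \<Sum>g | q g \<noteq> 0. q g * left_regular G g f x)"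

lemma left_regular_fun_indicator:
  "left_regular_fun G (indicator S) f x = (\<Sum>s\<in>S. left_regular G s f x)"
  by (simp add: left_regular_fun_def indicator_def)

definition rapid_decay_exponent :: "('a, 'b) monoid_scheme \<Rightarrow> real \<Rightarrow> bool" where
  "rapid_decay_exponent G C1 \<longleftrightarrow>
     C1 > 0 \<and>
     (\<exists>C > 0. \<exists>T. finite_generating_set G T \<and>
       (\<forall>q. finite {g. q g \<noteq> 0} \<and> {g. q g \<noteq> 0} \<subseteq> carrier G \<longrightarrow>
         op_norm (carrier G) (left_regular_fun G q)
           \<le> C * real (supp_diam G T q) powr C1 * sqrt (\<Sum>g | q g \<noteq> 0. (cmod (q g))\<^sup>2)))"

end

theory Submission
  imports Defs "HOL-Real_Asymp.Real_Asymp"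
begin

text \<open>Write \<open>\<rho> = R\<^sup>z \<delta>\<^sub>e\<close> with \<open>z = E + i \<eta>\<close> for the Green function. As \<open>P\<close> is a real symmetric
  matrix that is invariant under right translations, \<open>(\<Im> R\<^sup>z)(e, g) = \<Im> \<rho>(g)\<close> and
  \<open>\<rho>(g\<inverse>) = \<rho>(g)\<close>. Two general facts bound \<open>\<rho>\<close>: positivity of \<open>\<Im> R\<^sup>z\<close> gives
  \<open>\<bar>\<Im> \<rho>(g)\<bar> \<le> \<Im> \<rho>(e) \<le> C\<^sub>0\<close> (\<open>abs_Im_green_le\<close>), and the Ward identity gives
  \<open>\<Sum>\<^sub>g \<bar>\<rho>(g)\<bar>\<^sup>2 = \<Im> \<rho>(e) / \<eta> \<le> C\<^sub>0 / \<eta>\<close> (\<open>ward_identity\<close>). Without the weight \<open>\<bar>g\<bar>\<^bsup>c\<^esup>\<close> they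
  bound the sum by \<open>C\<^sub>0\<^sup>3 \<eta>\<close>. To absorb the weight, it suffices that \<open>\<rho>\<close> takes the value \<open>\<rho>(g)\<close> at
  exponentially many points: if it does so at \<open>N\<close> points, then \<open>\<bar>\<rho>(g)\<bar>\<^sup>2 \<le> C\<^sub>0 / (\<eta> N)\<close>, and the geometric
  mean of this bound and \<open>C\<^sub>0\<^sup>2\<close> gives \<open>\<bar>\<Im> \<rho>(g)\<bar>\<^sup>2 \<bar>g\<bar>\<^bsup>c\<^esup> \<le> K \<eta>\<^bsup>-1/2\<^esup>\<close> for every power \<open>c\<close>
  (\<open>weighted_green_bound\<close>). Then the sum is at most \<open>\<eta>\<^sup>2 (K \<eta>\<^bsup>-1/2\<^esup>) (C\<^sub>0 / \<eta>) = C\<^sub>0 K \<eta>\<^bsup>1/2\<^esup>\<close>.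

  The many points come from automorphisms of the unlabelled Cayley graph that fix \<open>e\<close>, under which \<open>\<rho>\<close>
  is invariant (\<open>green_invariant\<close>). If an automorphism \<open>\<phi>\<close> of the diagram fixes a generator \<open>s\<close> and its
  neighbours, the graph can be bent along the wall of \<open>s\<close>: \<open>\<phi>\<close> is applied on one side of the wall and
  the identity on the other (\<open>bend_aut\<close>). After a right translation this changes a geodesic word
  \<open>a s b\<close> into \<open>\<phi>(a) s b\<close> (\<open>bend_geodesic\<close>).

  A geodesic word is cut into blocks of length \<open>\<bar>S\<bar> + 1\<close>. Each block contains two letters that do not
  commute, for which super-flexibility provides a bend, either in the word or in the reversed word
  (\<open>long_geodesic_flexible\<close>). Such a bend exchanges two letters \<open>t\<close> and \<open>u\<close> that do not commute, and
  the subword in \<open>t\<close> and \<open>u\<close> of a geodesic word depends only on the group element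
  (\<open>geodesic_filter_unique\<close>). Hence bends in different blocks lead to different elements, and each block
  doubles their number (\<open>flexible_doubling\<close>).\<close>

section \<open>Square-summable functions\<close>

abbreviation sqnorm :: "'a set \<Rightarrow> ('a \<Rightarrow> complex) \<Rightarrow> real" where
  "sqnorm X f \<equiv> \<Sum>\<^sub>\<infinity>x\<in>X. (cmod (f x))\<^sup>2"

lemma ell2_square_summable: "f \<in> ell2 X \<Longrightarrow> (\<lambda>x. (cmod (f x))\<^sup>2) summable_on X"
  by (simp add: ell2_def)

lemma sqnorm_nonneg: "0 \<le> sqnorm X f"
  by (rule infsum_nonneg) simp

lemma ell2_inner_summable:
  assumes "f \<in> ell2 X" "h \<in> ell2 X"
  shows "(\<lambda>x. cnj (f x) * h x) summable_on X"
proof -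
  have "(\<lambda>x. norm (cnj (f x) * h x)) summable_on X"
    by (rule abs_summable_product)
      (use assms in \<open>simp_all add: ell2_def norm_mult power2_eq_square\<close>)
  then show ?thesis by (rule abs_summable_summable)
qed

lemma ell2_cnj: "f \<in> ell2 X \<Longrightarrow> (\<lambda>x. cnj (f x)) \<in> ell2 X"
  by (simp add: ell2_def)

lemma ell2_scale: "f \<in> ell2 X \<Longrightarrow> (\<lambda>x. c * f x) \<in> ell2 X"
  by (auto simp: ell2_def norm_mult power_mult_distrib intro: summable_on_cmult_right)

lemma cmod_add_square_le: "(cmod (a + b))\<^sup>2 \<le> 2 * (cmod a)\<^sup>2 + 2 * (cmod b)\<^sup>2"
proof -
  have "(cmod (a + b))\<^sup>2 \<le> (cmod a + cmod b)\<^sup>2"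
    by (rule power_mono) (auto simp: norm_triangle_ineq)
  also have "\<dots> \<le> 2 * (cmod a)\<^sup>2 + 2 * (cmod b)\<^sup>2"
    using sum_squares_bound[of "cmod a" "cmod b"] by (simp add: power2_sum)
  finally show ?thesis .
qed

lemma ell2_add:
  assumes "f \<in> ell2 X" "h \<in> ell2 X"
  shows "(\<lambda>x. f x + h x) \<in> ell2 X"
proof -
  have "(\<lambda>x. 2 * (cmod (f x))\<^sup>2 + 2 * (cmod (h x))\<^sup>2) summable_on X"
    using assms by (intro summable_on_add summable_on_cmult_right) (auto simp: ell2_def)
  then have "(\<lambda>x. (cmod (f x + h x))\<^sup>2) summable_on X"
    by (rule summable_on_comparison_test) (auto simp: cmod_add_square_le)
  then show ?thesis using assms by (auto simp: ell2_def)
qed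

lemma ell2_diff_scaled:
  assumes "f \<in> ell2 X" "h \<in> ell2 X"
  shows "(\<lambda>x. f x - c * h x) \<in> ell2 X"
  using ell2_add[OF assms(1) ell2_scale[OF assms(2), of "- c"]] by simp

lemma ell2_sum:
  assumes "\<And>i. i \<in> I \<Longrightarrow> f i \<in> ell2 X"
  shows "(\<lambda>x. \<Sum>i\<in>I. f i x) \<in> ell2 X"
  using assms
proof (induction I rule: infinite_finite_induct)
  case (insert i I)
  then show ?case by (simp add: ell2_add)
qed (auto simp: ell2_def)

lemma
  fixes f :: "'i \<Rightarrow> 'a \<Rightarrow> 'b :: {topological_comm_monoid_add, t2_space}"
  assumes "finite I" "\<And>i. i \<in> I \<Longrightarrow> f i summable_on X"
  shows infsum_finite_sum: "(\<Sum>\<^sub>\<infinity>x\<in>X. \<Sum>i\<in>I. f i x) = (\<Sum>i\<in>I. \<Sum>\<^sub>\<infinity>x\<in>X. f i x)"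
    and summable_on_finite_sum: "(\<lambda>x. \<Sum>i\<in>I. f i x) summable_on X"
proof -
  have *: "((\<lambda>x. \<Sum>i\<in>I. f i x) has_sum (\<Sum>i\<in>I. \<Sum>\<^sub>\<infinity>x\<in>X. f i x)) X"
    using assms by (induction I rule: finite_induct) (auto intro!: has_sum_add)
  from * show "(\<Sum>\<^sub>\<infinity>x\<in>X. \<Sum>i\<in>I. f i x) = (\<Sum>i\<in>I. \<Sum>\<^sub>\<infinity>x\<in>X. f i x)" by (rule infsumI)
  from * show "(\<lambda>x. \<Sum>i\<in>I. f i x) summable_on X" by (rule has_sum_imp_summable)
qed

lemma ell2_of_finite_sums:
  assumes "\<And>x. x \<notin> X \<Longrightarrow> f x = 0"
    and "\<And>F. finite F \<Longrightarrow> F \<subseteq> X \<Longrightarrow> (\<Sum>x\<in>F. (cmod (f x))\<^sup>2) \<le> B"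
  shows "f \<in> ell2 X"
  using assms unfolding ell2_def
  by (auto intro!: nonneg_bdd_above_summable_on bdd_aboveI2[where M = B])

lemma sum_le_sqnorm:
  assumes "f \<in> ell2 X" "finite F" "F \<subseteq> X"
  shows "(\<Sum>x\<in>F. (cmod (f x))\<^sup>2) \<le> sqnorm X f"
  by (rule finite_sum_le_infsum) (use assms in \<open>auto simp: ell2_def\<close>)

lemma sqnorm_eq_0:
  assumes "f \<in> ell2 X" "sqnorm X f \<le> 0"
  shows "f = (\<lambda>x. 0)"
proof
  fix x
  show "f x = 0"
  proof (cases "x \<in> X")
    case True
    then have "(cmod (f x))\<^sup>2 \<le> sqnorm X f"
      using sum_le_sqnorm[OF assms(1), of "{x}"] by simp
    then have "(cmod (f x))\<^sup>2 \<le> 0" using assms(2) by linarith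
    then show ?thesis by simp
  qed (use assms in \<open>auto simp: ell2_def\<close>)
qed

lemma delta_ell2: "g \<in> X \<Longrightarrow> delta g \<in> ell2 X"
proof (rule ell2_of_finite_sums[where B = 1])
  fix F :: "'a set" assume "finite F"
  then show "(\<Sum>x\<in>F. (cmod (delta g x))\<^sup>2) \<le> 1"
    by (simp add: delta_def if_distrib[of cmod] if_distrib[of "\<lambda>x. x\<^sup>2"] sum.delta cong: if_cong)
qed (auto simp: delta_def)

lemma ell2_inner_delta_left: "g \<in> X \<Longrightarrow> ell2_inner X (delta g) f = f g"
proof -
  assume g: "g \<in> X"
  have "ell2_inner X (delta g) f = (\<Sum>\<^sub>\<infinity>x\<in>{g}. cnj (delta g x) * f x)"
    unfolding ell2_inner_def by (rule infsum_cong_neutral) (use g in \<open>auto simp: delta_def\<close>)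
  then show ?thesis by (simp add: delta_def)
qed

lemma ell2_inner_cnj_swap: "ell2_inner X h f = cnj (ell2_inner X f h)"
  unfolding ell2_inner_def by (simp add: mult.commute flip: infsum_cnj)

lemma ell2_inner_delta_right: "g \<in> X \<Longrightarrow> ell2_inner X f (delta g) = cnj (f g)"
  by (subst ell2_inner_cnj_swap) (simp add: ell2_inner_delta_left)

lemma ell2_inner_diff_scaled:
  assumes "f \<in> ell2 X" "h \<in> ell2 X" "k \<in> ell2 X"
  shows "ell2_inner X f (\<lambda>x. h x - c * k x) = ell2_inner X f h - c * ell2_inner X f k"
proof -
  have "ell2_inner X f (\<lambda>x. h x - c * k x)
      = (\<Sum>\<^sub>\<infinity>x\<in>X. cnj (f x) * h x + (- c) * (cnj (f x) * k x))"
    unfolding ell2_inner_def by (rule infsum_cong) (simp add: algebra_simps)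
  also have "\<dots> = ell2_inner X f h + (- c) * ell2_inner X f k"
    unfolding ell2_inner_def
    by (subst infsum_add) (intro summable_on_cmult_right ell2_inner_summable assms
        | simp only: infsum_cmult_right')+
  finally show ?thesis by simp
qed

lemma ell2_inner_self: "f \<in> ell2 X \<Longrightarrow> ell2_inner X f f = of_real (sqnorm X f)"
proof -
  assume "f \<in> ell2 X"
  then have "((\<lambda>x. complex_of_real ((cmod (f x))\<^sup>2)) has_sum of_real (sqnorm X f)) X"
    by (intro has_sum_of_real has_sum_infsum ell2_square_summable)
  then show ?thesis
    unfolding ell2_inner_def complex_norm_square by (intro infsumI) (simp add: mult.commute)
qed

text \<open>For two functions of the same norm this is the Cauchy--Schwarz inequality; it follows from
  \<open>2 \<bar>a b\<bar> \<le> \<bar>a\<bar>\<^sup>2 + \<bar>b\<bar>\<^sup>2\<close> at each point.\<close>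

lemma cmod_ell2_inner_le:
  assumes "f \<in> ell2 X" "h \<in> ell2 X"
  shows "cmod (ell2_inner X f h) \<le> (sqnorm X f + sqnorm X h) / 2"
proof -
  have s: "(\<lambda>x. ((cmod (f x))\<^sup>2 + (cmod (h x))\<^sup>2) * (1/2)) summable_on X"
    using assms by (intro summable_on_cmult_left summable_on_add) (auto simp: ell2_def)
  have "cmod (ell2_inner X f h) \<le> (\<Sum>\<^sub>\<infinity>x\<in>X. ((cmod (f x))\<^sup>2 + (cmod (h x))\<^sup>2) * (1/2))"
    unfolding ell2_inner_def
  proof (rule norm_infsum_le)
    show "((\<lambda>x. cnj (f x) * h x) has_sum (\<Sum>\<^sub>\<infinity>x\<in>X. cnj (f x) * h x)) X"
      by (rule has_sum_infsum[OF ell2_inner_summable[OF assms]])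
    show "((\<lambda>x. ((cmod (f x))\<^sup>2 + (cmod (h x))\<^sup>2) * (1/2)) has_sum
      (\<Sum>\<^sub>\<infinity>x\<in>X. ((cmod (f x))\<^sup>2 + (cmod (h x))\<^sup>2) * (1/2))) X"
      by (rule has_sum_infsum[OF s])
    fix x
    show "cmod (cnj (f x) * h x) \<le> ((cmod (f x))\<^sup>2 + (cmod (h x))\<^sup>2) * (1/2)"
      using sum_squares_bound[of "cmod (f x)" "cmod (h x)"] by (simp add: norm_mult)
  qed
  also have "\<dots> = (sqnorm X f + sqnorm X h) / 2"
    unfolding infsum_cmult_left' by (subst infsum_add) (use assms in \<open>auto simp: ell2_def\<close>)
  finally show ?thesis .
qed

lemma ell2_reindex:
  assumes "bij_betw \<theta> X X" "f \<in> ell2 X"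
  shows "(\<lambda>x. if x \<in> X then f (\<theta> x) else 0) \<in> ell2 X"
    and "sqnorm X (\<lambda>x. if x \<in> X then f (\<theta> x) else 0) = sqnorm X f"
proof -
  have "(\<lambda>x. (cmod (f (\<theta> x)))\<^sup>2) summable_on X"
    using summable_on_reindex_bij_betw[OF assms(1), of "\<lambda>x. (cmod (f x))\<^sup>2"] assms(2)
    by (simp add: ell2_def)
  then have "(\<lambda>x. (cmod (if x \<in> X then f (\<theta> x) else 0))\<^sup>2) summable_on X"
    by (rule summable_on_cong[THEN iffD1, rotated]) simp
  then show "(\<lambda>x. if x \<in> X then f (\<theta> x) else 0) \<in> ell2 X"
    by (simp add: ell2_def)
  have "sqnorm X (\<lambda>x. if x \<in> X then f (\<theta> x) else 0) = (\<Sum>\<^sub>\<infinity>x\<in>X. (cmod (f (\<theta> x)))\<^sup>2)"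
    by (rule infsum_cong) simp
  also have "\<dots> = sqnorm X f"
    by (rule infsum_reindex_bij_betw[OF assms(1), of "\<lambda>x. (cmod (f x))\<^sup>2"])
  finally show "sqnorm X (\<lambda>x. if x \<in> X then f (\<theta> x) else 0) = sqnorm X f" .
qed

lemma L2_set_cmod_sum_le:
  fixes a :: "nat \<Rightarrow> 'b \<Rightarrow> complex"
  shows "L2_set (\<lambda>x. cmod (\<Sum>k<K. a k x)) F \<le> (\<Sum>k<K. L2_set (\<lambda>x. cmod (a k x)) F)"
proof (induction K)
  case (Suc K)
  have "L2_set (\<lambda>x. cmod (\<Sum>k<Suc K. a k x)) F
      \<le> L2_set (\<lambda>x. cmod (\<Sum>k<K. a k x) + cmod (a K x)) F"
    by (intro L2_set_mono) (auto simp: norm_triangle_ineq)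
  also have "\<dots> \<le> L2_set (\<lambda>x. cmod (\<Sum>k<K. a k x)) F + L2_set (\<lambda>x. cmod (a K x)) F"
    by (rule L2_set_triangle_ineq)
  finally show ?case using Suc by simp
qed (simp add: L2_set_def)

section \<open>The resolvent of the adjacency operator\<close>

locale involution_group = group G for G (structure) +
  fixes S
  assumes finite_S: "finite S"
    and S_carrier: "S \<subseteq> carrier G"
    and S_involution: "s \<in> S \<Longrightarrow> s \<otimes> s = \<one>"
begin

lemma S_closed [simp]: "s \<in> S \<Longrightarrow> s \<in> carrier G"
  using S_carrier by auto

lemma S_cancel [simp]: "s \<in> S \<Longrightarrow> x \<in> carrier G \<Longrightarrow> s \<otimes> (s \<otimes> x) = x"
  using S_involution[of s] by (simp flip: m_assoc)

lemma S_inv: "s \<in> S \<Longrightarrow> inv s = s"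
  using S_involution[of s] by (simp add: inv_equality)

lemma S_mult_bij: "s \<in> S \<Longrightarrow> bij_betw (\<lambda>x. s \<otimes> x) (carrier G) (carrier G)"
  by (rule bij_betw_byWitness[where f' = "\<lambda>x. s \<otimes> x"]) auto

text \<open>The adjacency operator of the Cayley graph: it is \<open>\<lambda>(\<one>\<^sub>S)\<close>, written without inverses because
  the generators are involutions.\<close>

definition adjacency :: "'a oper" where
  "adjacency f = (\<lambda>x. if x \<in> carrier G then \<Sum>s\<in>S. f (s \<otimes> x) else 0)"

lemma left_regular_fun_eq_adjacency: "left_regular_fun G (indicator S) = adjacency"
  by (auto simp: fun_eq_iff left_regular_fun_indicator adjacency_def left_regular_def S_inv)

lemma adjacency_eq_sum:
  "adjacency f = (\<lambda>x. \<Sum>s\<in>S. if x \<in> carrier G then f (s \<otimes> x) else 0)"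
  by (auto simp: adjacency_def)

lemma adjacency_ell2: "f \<in> ell2 (carrier G) \<Longrightarrow> adjacency f \<in> ell2 (carrier G)"
  unfolding adjacency_eq_sum by (intro ell2_sum ell2_reindex(1) S_mult_bij)

lemma adjacency_linear:
  "adjacency (\<lambda>x. f x - c * h x) = (\<lambda>x. adjacency f x - c * adjacency h x)"
  by (auto simp: adjacency_def sum_subtractf sum_distrib_left fun_eq_iff)

lemma adjacency_cnj: "adjacency (\<lambda>x. cnj (f x)) = (\<lambda>x. cnj (adjacency f x))"
  by (auto simp: adjacency_def fun_eq_iff)

lemma adjacency_self_adjoint:
  assumes "f \<in> ell2 (carrier G)" "h \<in> ell2 (carrier G)"
  shows "ell2_inner (carrier G) f (adjacency h) = ell2_inner (carrier G) (adjacency f) h"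
proof -
  let ?X = "carrier G"
  let ?sh = "\<lambda>s f x. if x \<in> ?X then f (s \<otimes> x) else (0::complex)"
  have sh: "?sh s f \<in> ell2 ?X" if "s \<in> S" "f \<in> ell2 ?X" for s f
    using that by (intro ell2_reindex(1) S_mult_bij)
  have "ell2_inner ?X f (adjacency h) = (\<Sum>\<^sub>\<infinity>x\<in>?X. \<Sum>s\<in>S. cnj (f x) * ?sh s h x)"
    unfolding ell2_inner_def adjacency_eq_sum by (simp add: sum_distrib_left)
  also have "\<dots> = (\<Sum>s\<in>S. \<Sum>\<^sub>\<infinity>x\<in>?X. cnj (f x) * ?sh s h x)"
    by (rule infsum_finite_sum[OF finite_S]) (intro ell2_inner_summable assms sh)
  also have "\<dots> = (\<Sum>s\<in>S. \<Sum>\<^sub>\<infinity>x\<in>?X. cnj (?sh s f x) * h x)"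
  proof (rule sum.cong)
    fix s assume s: "s \<in> S"
    have "(\<Sum>\<^sub>\<infinity>x\<in>?X. cnj (f x) * ?sh s h x)
        = (\<Sum>\<^sub>\<infinity>x\<in>?X. (\<lambda>x. cnj (f x) * ?sh s h x) (s \<otimes> x))"
      by (rule infsum_reindex_bij_betw[OF S_mult_bij[OF s], symmetric])
    also have "\<dots> = (\<Sum>\<^sub>\<infinity>x\<in>?X. cnj (?sh s f x) * h x)"
      by (rule infsum_cong) (use s in auto)
    finally show "(\<Sum>\<^sub>\<infinity>x\<in>?X. cnj (f x) * ?sh s h x) = (\<Sum>\<^sub>\<infinity>x\<in>?X. cnj (?sh s f x) * h x)" .
  qed simp
  also have "\<dots> = (\<Sum>\<^sub>\<infinity>x\<in>?X. \<Sum>s\<in>S. cnj (?sh s f x) * h x)"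
    by (rule infsum_finite_sum[OF finite_S, symmetric]) (intro ell2_inner_summable assms sh)
  also have "\<dots> = ell2_inner ?X (adjacency f) h"
    unfolding ell2_inner_def adjacency_eq_sum by (simp add: sum_distrib_right)
  finally show ?thesis .
qed

lemma Im_inner_adjacency:
  assumes "f \<in> ell2 (carrier G)"
  shows "Im (ell2_inner (carrier G) f (adjacency f)) = 0"
proof -
  have "cnj (ell2_inner (carrier G) f (adjacency f)) = ell2_inner (carrier G) f (adjacency f)"
    by (metis adjacency_self_adjoint[OF assms assms] ell2_inner_cnj_swap)
  then show ?thesis by (simp add: complex_eq_iff)
qed

lemma shifted_adjacency_ell2:
  "f \<in> ell2 (carrier G) \<Longrightarrow> (\<lambda>x. adjacency f x - z * f x) \<in> ell2 (carrier G)"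
  by (intro ell2_diff_scaled adjacency_ell2)

lemma shifted_adjacency_adjoint:
  assumes "f \<in> ell2 (carrier G)" "h \<in> ell2 (carrier G)"
  shows "ell2_inner (carrier G) f (\<lambda>x. adjacency h x - z * h x)
    = ell2_inner (carrier G) (\<lambda>x. adjacency f x - cnj z * f x) h"
proof -
  have "ell2_inner (carrier G) f (\<lambda>x. adjacency h x - z * h x)
      = ell2_inner (carrier G) f (adjacency h) - z * ell2_inner (carrier G) f h"
    using assms by (intro ell2_inner_diff_scaled adjacency_ell2)
  also have "\<dots> = cnj (ell2_inner (carrier G) h (adjacency f) - cnj z * ell2_inner (carrier G) h f)"
    using adjacency_self_adjoint[OF assms] ell2_inner_cnj_swap[of "carrier G" f h]
      ell2_inner_cnj_swap[of "carrier G" "adjacency f" h] by simp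
  also have "\<dots> = cnj (ell2_inner (carrier G) h (\<lambda>x. adjacency f x - cnj z * f x))"
    using assms by (subst ell2_inner_diff_scaled) (auto intro: adjacency_ell2)
  finally show ?thesis by (simp flip: ell2_inner_cnj_swap)
qed

lemma Im_inner_shifted_adjacency:
  assumes "f \<in> ell2 (carrier G)"
  shows "Im (ell2_inner (carrier G) f (\<lambda>x. adjacency f x - z * f x)) = - Im z * sqnorm (carrier G) f"
  using assms Im_inner_adjacency[OF assms]
  by (simp add: ell2_inner_diff_scaled adjacency_ell2 ell2_inner_self)

lemma shifted_adjacency_kernel_trivial:
  assumes "f \<in> ell2 (carrier G)" "Im z \<noteq> 0" "(\<lambda>x. adjacency f x - z * f x) = (\<lambda>x. 0)"
  shows "f = (\<lambda>x. 0)"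
proof (rule sqnorm_eq_0[OF assms(1)])
  have "- Im z * sqnorm (carrier G) f = 0"
    using Im_inner_shifted_adjacency[OF assms(1), of z] assms(3) by (simp add: ell2_inner_def)
  then show "sqnorm (carrier G) f \<le> 0" using assms(2) by simp
qed

lemma shifted_adjacency_inj:
  assumes "Im z \<noteq> 0"
  shows "inj_on (\<lambda>f x. adjacency f x - z * f x) (ell2 (carrier G))"
proof (rule inj_onI)
  fix f h assume fh: "f \<in> ell2 (carrier G)" "h \<in> ell2 (carrier G)"
    and eq: "(\<lambda>x. adjacency f x - z * f x) = (\<lambda>x. adjacency h x - z * h x)"
  have "(\<lambda>x. f x - 1 * h x) = (\<lambda>x. 0)"
  proof (rule shifted_adjacency_kernel_trivial[OF _ assms])
    show "(\<lambda>x. f x - 1 * h x) \<in> ell2 (carrier G)" by (rule ell2_diff_scaled[OF fh])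
    show "(\<lambda>x. adjacency (\<lambda>x. f x - 1 * h x) x - z * (f x - 1 * h x)) = (\<lambda>x. 0)"
      unfolding adjacency_linear using eq by (simp add: fun_eq_iff algebra_simps)
  qed
  then show "f = h" by (simp add: fun_eq_iff)
qed

lemma sqnorm_adjacency_le:
  assumes "f \<in> ell2 (carrier G)"
  shows "sqnorm (carrier G) (adjacency f) \<le> (real (card S))\<^sup>2 * sqnorm (carrier G) f"
proof -
  let ?X = "carrier G"
  let ?sh = "\<lambda>s x. if x \<in> ?X then f (s \<otimes> x) else 0"
  have sh: "?sh s \<in> ell2 ?X" "sqnorm ?X (?sh s) = sqnorm ?X f" if "s \<in> S" for s
    using that assms by (intro ell2_reindex S_mult_bij; simp)+
  have "sqnorm ?X (adjacency f) \<le> (\<Sum>\<^sub>\<infinity>x\<in>?X. (\<Sum>s\<in>S. (cmod (?sh s x))\<^sup>2 * real (card S)))"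
  proof (rule infsum_mono)
    show "(\<lambda>x. (cmod (adjacency f x))\<^sup>2) summable_on ?X"
      using adjacency_ell2[OF assms] by (rule ell2_square_summable)
    show "(\<lambda>x. \<Sum>s\<in>S. (cmod (?sh s x))\<^sup>2 * real (card S)) summable_on ?X"
      by (intro summable_on_finite_sum summable_on_cmult_left ell2_square_summable sh finite_S)
    fix x assume "x \<in> ?X"
    have "(cmod (adjacency f x))\<^sup>2 \<le> (\<Sum>s\<in>S. cmod (?sh s x))\<^sup>2"
      unfolding adjacency_eq_sum by (intro power_mono norm_sum norm_ge_zero)
    also have "\<dots> \<le> (\<Sum>s\<in>S. (cmod (?sh s x))\<^sup>2 * real (card S))"
      using sum_squared_le_sum_of_squares[of "\<lambda>s. cmod (?sh s x)" S] by (simp add: sum_distrib_right)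
    finally show "(cmod (adjacency f x))\<^sup>2 \<le> (\<Sum>s\<in>S. (cmod (?sh s x))\<^sup>2 * real (card S))" .
  qed
  also have "\<dots> = (\<Sum>s\<in>S. sqnorm ?X (?sh s) * real (card S))"
    by (subst infsum_finite_sum[OF finite_S])
      (intro summable_on_cmult_left ell2_square_summable sh | simp only: infsum_cmult_left')+
  also have "\<dots> = (\<Sum>s\<in>S. sqnorm ?X f * real (card S))"
    by (rule sum.cong) (simp_all only: sh)
  also have "\<dots> = (real (card S))\<^sup>2 * sqnorm ?X f"
    by (simp add: power2_eq_square)
  finally show ?thesis .
qed

text \<open>The equation \<open>(P - z) f = h\<close> is the fixed point equation \<open>f = T f + i \<delta> h\<close> for
  \<open>T = Id - i \<delta> (P - z)\<close>. For self-adjoint \<open>P\<close> and \<open>z = E + i \<eta>\<close> the operator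
  \<open>T = (1 - \<delta> \<eta>) Id - i \<delta> (P - E)\<close> is normal, and for small \<open>\<delta>\<close> of the sign of \<open>\<eta>\<close> it is a strict
  contraction: the gain \<open>2 \<delta> \<eta>\<close> is linear in \<open>\<delta>\<close> and the loss \<open>\<delta>\<^sup>2 (\<parallel>P - E\<parallel>\<^sup>2 + \<eta>\<^sup>2)\<close> quadratic.\<close>

definition neumann_step :: "real \<Rightarrow> complex \<Rightarrow> 'a oper" where
  "neumann_step \<delta> z f = (\<lambda>x. f x - \<i> * \<delta> * (adjacency f x - z * f x))"

lemma neumann_step_ell2:
  "f \<in> ell2 (carrier G) \<Longrightarrow> neumann_step \<delta> z f \<in> ell2 (carrier G)"
  unfolding neumann_step_def by (intro ell2_diff_scaled shifted_adjacency_ell2)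

lemma sqnorm_neumann_step:
  fixes z :: complex
  assumes f: "f \<in> ell2 (carrier G)"
  defines "A \<equiv> \<lambda>x. adjacency f x - of_real (Re z) * f x"
  shows "sqnorm (carrier G) (neumann_step \<delta> z f)
    = (1 - \<delta> * Im z)\<^sup>2 * sqnorm (carrier G) f + \<delta>\<^sup>2 * sqnorm (carrier G) A"
proof -
  let ?X = "carrier G" and ?a = "1 - \<delta> * Im z"
  have A: "A \<in> ell2 ?X" unfolding A_def by (rule shifted_adjacency_ell2[OF f])
  have pointwise: "(cmod (neumann_step \<delta> z f x))\<^sup>2
      = ?a\<^sup>2 * (cmod (f x))\<^sup>2 + \<delta>\<^sup>2 * (cmod (A x))\<^sup>2 + 2 * ?a * \<delta> * Im (cnj (f x) * A x)" for x
    unfolding cmod_power2 neumann_step_def A_def by (simp add: power2_eq_square algebra_simps)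
  have sums: "((\<lambda>x. (cmod (f x))\<^sup>2) has_sum sqnorm ?X f) ?X"
    "((\<lambda>x. (cmod (A x))\<^sup>2) has_sum sqnorm ?X A) ?X"
    "((\<lambda>x. Im (cnj (f x) * A x)) has_sum Im (ell2_inner ?X f A)) ?X"
    unfolding ell2_inner_def
    by (intro has_sum_infsum has_sum_Im ell2_square_summable ell2_inner_summable f A)+
  have "((\<lambda>x. ?a\<^sup>2 * (cmod (f x))\<^sup>2 + \<delta>\<^sup>2 * (cmod (A x))\<^sup>2 + 2 * ?a * \<delta> * Im (cnj (f x) * A x))
      has_sum (?a\<^sup>2 * sqnorm ?X f + \<delta>\<^sup>2 * sqnorm ?X A + 2 * ?a * \<delta> * Im (ell2_inner ?X f A))) ?X"
    by (intro has_sum_add has_sum_cmult_right sums)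
  moreover have "Im (ell2_inner ?X f A) = 0"
    unfolding A_def by (subst Im_inner_shifted_adjacency[OF f]) simp
  ultimately show ?thesis unfolding pointwise by (simp add: infsumI)
qed

lemma neumann_step_contraction:
  assumes "Im z \<noteq> 0"
  obtains \<delta> q where "\<delta> \<noteq> 0" "0 \<le> q" "q < 1"
    "\<And>f. f \<in> ell2 (carrier G) \<Longrightarrow>
      sqnorm (carrier G) (neumann_step \<delta> z f) \<le> q * sqnorm (carrier G) f"
proof -
  let ?X = "carrier G"
  define M where "M = 2 * (real (card S))\<^sup>2 + 2 * (Re z)\<^sup>2"
  define D where "D = (Im z)\<^sup>2 + M"
  \<comment> \<open>the minimiser of \<open>(1 - \<delta> \<eta>)\<^sup>2 + \<delta>\<^sup>2 M\<close>\<close>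
  define \<delta> where "\<delta> = Im z / D"
  have M: "0 \<le> M" by (simp add: M_def)
  have D: "0 < D" using assms M by (simp add: D_def add_pos_nonneg)
  have q_eq: "(1 - \<delta> * Im z)\<^sup>2 + \<delta>\<^sup>2 * M = M / D"
  proof -
    have "(1 - \<delta> * Im z)\<^sup>2 + \<delta>\<^sup>2 * M = 1 - 2 * \<delta> * Im z + \<delta>\<^sup>2 * D"
      by (simp add: D_def power2_eq_square algebra_simps)
    also have "\<dots> = (D - (Im z)\<^sup>2) / D"
      using D by (simp add: \<delta>_def power2_eq_square field_simps)
    finally show ?thesis by (simp add: D_def)
  qed
  show ?thesis
  proof (rule that[of \<delta> "M / D"])
    show "\<delta> \<noteq> 0" using assms D by (simp add: \<delta>_def)
    show "0 \<le> M / D" using M D by simp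
    show "M / D < 1" using assms D by (simp add: D_def)
    fix f assume f: "f \<in> ell2 ?X"
    let ?A = "\<lambda>x. adjacency f x - of_real (Re z) * f x"
    have "sqnorm ?X ?A
        \<le> (\<Sum>\<^sub>\<infinity>x\<in>?X. 2 * (cmod (adjacency f x))\<^sup>2 + 2 * (Re z)\<^sup>2 * (cmod (f x))\<^sup>2)"
    proof (rule infsum_mono)
      show "(\<lambda>x. (cmod (?A x))\<^sup>2) summable_on ?X"
        by (rule ell2_square_summable[OF shifted_adjacency_ell2[OF f]])
      show "(\<lambda>x. 2 * (cmod (adjacency f x))\<^sup>2 + 2 * (Re z)\<^sup>2 * (cmod (f x))\<^sup>2) summable_on ?X"
        by (intro summable_on_add summable_on_cmult_right ell2_square_summable adjacency_ell2 f)
      show "(cmod (?A x))\<^sup>2 \<le> 2 * (cmod (adjacency f x))\<^sup>2 + 2 * (Re z)\<^sup>2 * (cmod (f x))\<^sup>2" for x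
        using cmod_add_square_le[of "adjacency f x" "- of_real (Re z) * f x"]
        by (simp add: norm_mult power_mult_distrib)
    qed
    also have "\<dots> = 2 * sqnorm ?X (adjacency f) + 2 * (Re z)\<^sup>2 * sqnorm ?X f"
      by (subst infsum_add)
        (intro summable_on_cmult_right ell2_square_summable adjacency_ell2 f
          | simp only: infsum_cmult_right')+
    also have "\<dots> \<le> M * sqnorm ?X f"
      using sqnorm_adjacency_le[OF f] by (simp add: M_def algebra_simps)
    finally have "\<delta>\<^sup>2 * sqnorm ?X ?A \<le> \<delta>\<^sup>2 * (M * sqnorm ?X f)"
      by (intro mult_left_mono) auto
    then have "sqnorm ?X (neumann_step \<delta> z f) \<le> ((1 - \<delta> * Im z)\<^sup>2 + \<delta>\<^sup>2 * M) * sqnorm ?X f"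
      unfolding sqnorm_neumann_step[OF f] by (simp add: algebra_simps)
    then show "sqnorm ?X (neumann_step \<delta> z f) \<le> M / D * sqnorm ?X f"
      by (simp only: q_eq)
  qed
qed

text \<open>The Neumann series of the contraction is summed pointwise. At each point \<open>P\<close> involves only finitely
  many values of its argument, so it can be applied term by term, and the sum is square-summable because
  the norms of its terms are dominated by a geometric series, uniformly over finite sets.\<close>

lemma shifted_adjacency_surj:
  assumes z: "Im z \<noteq> 0" and h: "h \<in> ell2 (carrier G)"
  obtains f where "f \<in> ell2 (carrier G)" "(\<lambda>x. adjacency f x - z * f x) = h"
proof -
  let ?X = "carrier G"
  obtain \<delta> q where \<delta>: "\<delta> \<noteq> 0" and q: "0 \<le> q" "q < 1"
    and contr: "\<And>f. f \<in> ell2 ?X \<Longrightarrow> sqnorm ?X (neumann_step \<delta> z f) \<le> q * sqnorm ?X f"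
    using neumann_step_contraction[OF z] by metis
  define a where "a k = (neumann_step \<delta> z ^^ k) (\<lambda>x. \<i> * \<delta> * h x)" for k
  have a_Suc: "a (Suc k) = neumann_step \<delta> z (a k)" for k by (simp add: a_def)
  have a_ell2: "a k \<in> ell2 ?X" for k
    by (induction k) (auto simp: a_def intro: ell2_scale[OF h] neumann_step_ell2)
  define N where "N = sqnorm ?X (a 0)"
  have N: "0 \<le> N" unfolding N_def by (rule sqnorm_nonneg)
  have a_norm: "sqnorm ?X (a k) \<le> q ^ k * N" for k
  proof (induction k)
    case (Suc k)
    have "sqnorm ?X (a (Suc k)) \<le> q * sqnorm ?X (a k)"
      unfolding a_Suc by (rule contr[OF a_ell2])
    also have "\<dots> \<le> q * (q ^ k * N)" by (rule mult_left_mono[OF Suc q(1)])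
    finally show ?case by simp
  qed (simp add: N_def)
  have a_L2: "L2_set (\<lambda>x. cmod (a k x)) F \<le> sqrt q ^ k * sqrt N"
    if "finite F" "F \<subseteq> ?X" for k F
  proof -
    have "(\<Sum>x\<in>F. (cmod (a k x))\<^sup>2) \<le> q ^ k * N"
      using sum_le_sqnorm[OF a_ell2 that] a_norm[of k] by (rule order_trans)
    then show ?thesis
      unfolding L2_set_def by (metis real_sqrt_le_iff real_sqrt_mult real_sqrt_power)
  qed
  have sqrt_q: "0 \<le> sqrt q" "sqrt q < 1" using q by auto
  have geo: "summable (\<lambda>k. sqrt q ^ k)"
    using sqrt_q by (intro summable_geometric) simp
  have a_summable: "summable (\<lambda>k. a k x)" for x
  proof (rule summable_comparison_test'[of "\<lambda>k. sqrt q ^ k * sqrt N" 0])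
    show "summable (\<lambda>k. sqrt q ^ k * sqrt N)" by (rule summable_mult2[OF geo])
    show "norm (a k x) \<le> sqrt q ^ k * sqrt N" for k
    proof (cases "x \<in> ?X")
      case True
      then show ?thesis using a_L2[of "{x}" k] by (simp add: L2_set_def)
    next
      case False
      then show ?thesis using a_ell2[of k] N q by (simp add: ell2_def)
    qed
  qed
  define f where "f x = (\<Sum>k. a k x)" for x
  have a_sums: "(\<lambda>k. a k x) sums f x" for x
    unfolding f_def by (rule summable_sums[OF a_summable])
  have f_outside: "f x = 0" if "x \<notin> ?X" for x
    unfolding f_def using that a_ell2 by (simp add: ell2_def)
  define B where "B = sqrt N * (\<Sum>k. sqrt q ^ k)"
  have f_ell2: "f \<in> ell2 ?X"
  proof (rule ell2_of_finite_sums[where B = "B\<^sup>2"])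
    fix F assume F: "finite F" "F \<subseteq> ?X"
    have "(\<Sum>x\<in>F. (cmod (\<Sum>k<K. a k x))\<^sup>2) \<le> B\<^sup>2" for K
    proof -
      have "L2_set (\<lambda>x. cmod (\<Sum>k<K. a k x)) F \<le> (\<Sum>k<K. L2_set (\<lambda>x. cmod (a k x)) F)"
        by (rule L2_set_cmod_sum_le)
      also have "\<dots> \<le> (\<Sum>k<K. sqrt q ^ k * sqrt N)" by (intro sum_mono a_L2 F)
      also have "\<dots> = sqrt N * (\<Sum>k<K. sqrt q ^ k)" by (simp add: sum_distrib_left mult.commute)
      also have "\<dots> \<le> B"
        unfolding B_def by (intro mult_left_mono sum_le_suminf geo) (use N sqrt_q in auto)
      finally have "L2_set (\<lambda>x. cmod (\<Sum>k<K. a k x)) F \<le> B" .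
      then have "(L2_set (\<lambda>x. cmod (\<Sum>k<K. a k x)) F)\<^sup>2 \<le> B\<^sup>2"
        by (intro power_mono L2_set_nonneg)
      then show ?thesis by (simp add: L2_set_def sum_nonneg)
    qed
    moreover have "(\<lambda>K. \<Sum>x\<in>F. (cmod (\<Sum>k<K. a k x))\<^sup>2) \<longlonglongrightarrow> (\<Sum>x\<in>F. (cmod (f x))\<^sup>2)"
      using a_sums unfolding sums_def by (intro tendsto_intros)
    ultimately show "(\<Sum>x\<in>F. (cmod (f x))\<^sup>2) \<le> B\<^sup>2"
      by (intro LIMSEQ_le_const2) auto
  qed (rule f_outside)
  have "(\<lambda>x. adjacency f x - z * f x) = h"
  proof
    fix x
    have "(\<lambda>k. adjacency (a k) x) sums adjacency f x"
      unfolding adjacency_def by (auto intro!: sums_sum a_sums)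
    then have "(\<lambda>k. a (Suc k) x) sums neumann_step \<delta> z f x"
      unfolding a_Suc neumann_step_def by (intro sums_diff sums_mult a_sums)
    moreover have "(\<lambda>k. a (Suc k) x) sums (f x - a 0 x)"
      using a_sums[of x] by (simp add: sums_Suc_iff[of "\<lambda>k. a k x"])
    ultimately have "neumann_step \<delta> z f x = f x - a 0 x"
      by (rule sums_unique2)
    then show "adjacency f x - z * f x = h x"
      using \<delta> by (simp add: neumann_step_def a_def)
  qed
  with f_ell2 show ?thesis by (rule that)
qed

abbreviation resolvent :: "complex \<Rightarrow> 'a oper" where
  "resolvent \<equiv> resolvent_op (carrier G) adjacency"

lemma resolvent_eqI:
  assumes "Im z \<noteq> 0" "f \<in> ell2 (carrier G)" "(\<lambda>x. adjacency f x - z * f x) = h"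
  shows "resolvent z h = f"
  unfolding resolvent_op_def using the_inv_into_f_f[OF shifted_adjacency_inj[OF assms(1)] assms(2)]
  by (simp add: assms(3))

lemma
  assumes "Im z \<noteq> 0" "h \<in> ell2 (carrier G)"
  shows resolvent_ell2: "resolvent z h \<in> ell2 (carrier G)"
    and resolvent_equation: "(\<lambda>x. adjacency (resolvent z h) x - z * resolvent z h x) = h"
proof -
  obtain f where f: "f \<in> ell2 (carrier G)" "(\<lambda>x. adjacency f x - z * f x) = h"
    using shifted_adjacency_surj[OF assms] .
  with resolvent_eqI[OF assms(1) f]
  show "resolvent z h \<in> ell2 (carrier G)"
    "(\<lambda>x. adjacency (resolvent z h) x - z * resolvent z h x) = h" by simp_all
qed

lemma adjoint_resolvent:
  assumes z: "Im z \<noteq> 0" and h: "h \<in> ell2 (carrier G)"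
  shows "adjoint_op (carrier G) (resolvent z) h = resolvent (cnj z) h"
proof -
  let ?X = "carrier G"
  have cz: "Im (cnj z) \<noteq> 0" using z by simp
  have ex: "ell2_inner ?X (resolvent (cnj z) h) k = ell2_inner ?X h (resolvent z k)"
    if k: "k \<in> ell2 ?X" for k
    using shifted_adjacency_adjoint[OF resolvent_ell2[OF cz h] resolvent_ell2[OF z k], of z]
    unfolding resolvent_equation[OF cz h] resolvent_equation[OF z k] .
  show ?thesis
    unfolding adjoint_op_def
  proof (rule the_equality)
    fix g assume g: "g \<in> ell2 ?X \<and> (\<forall>k\<in>ell2 ?X. ell2_inner ?X g k = ell2_inner ?X h (resolvent z k))"
    show "g = resolvent (cnj z) h"
    proof
      fix x
      show "g x = resolvent (cnj z) h x"
      proof (cases "x \<in> ?X")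
        case True
        then have "ell2_inner ?X g (delta x) = ell2_inner ?X (resolvent (cnj z) h) (delta x)"
          using g ex delta_ell2 by metis
        with True show ?thesis by (simp add: ell2_inner_delta_right)
      next
        case False
        then show ?thesis using g resolvent_ell2[OF cz h] by (simp add: ell2_def)
      qed
    qed
  qed (use ex resolvent_ell2[OF cz h] in auto)
qed

section \<open>The Green function\<close>

definition green :: "complex \<Rightarrow> 'a \<Rightarrow> complex" where
  "green z = resolvent z (delta \<one>)"

lemma green_ell2: "Im z \<noteq> 0 \<Longrightarrow> green z \<in> ell2 (carrier G)"
  unfolding green_def by (intro resolvent_ell2 delta_ell2) auto

lemma green_equation: "Im z \<noteq> 0 \<Longrightarrow> (\<lambda>x. adjacency (green z) x - z * green z x) = delta \<one>"
  unfolding green_def by (intro resolvent_equation delta_ell2) auto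

lemma mult_right_bij: "g \<in> carrier G \<Longrightarrow> bij_betw (\<lambda>x. x \<otimes> g) (carrier G) (carrier G)"
  by (rule bij_betw_byWitness[where f' = "\<lambda>x. x \<otimes> inv g"]) (auto simp: m_assoc)

lemma resolvent_delta:
  assumes z: "Im z \<noteq> 0" and g: "g \<in> carrier G"
  shows "resolvent z (delta g) = (\<lambda>x. if x \<in> carrier G then green z (x \<otimes> inv g) else 0)"
proof (rule resolvent_eqI[OF z])
  let ?r = "\<lambda>x. if x \<in> carrier G then green z (x \<otimes> inv g) else 0"
  show "?r \<in> ell2 (carrier G)"
    by (rule ell2_reindex(1)[OF mult_right_bij green_ell2[OF z]]) (use g in simp)
  show "(\<lambda>x. adjacency ?r x - z * ?r x) = delta g"
  proof
    fix x
    show "adjacency ?r x - z * ?r x = delta g x"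
    proof (cases "x \<in> carrier G")
      case True
      have "adjacency ?r x - z * ?r x
          = adjacency (green z) (x \<otimes> inv g) - z * green z (x \<otimes> inv g)"
        using True g by (simp add: adjacency_def m_assoc)
      also have "\<dots> = delta \<one> (x \<otimes> inv g)" using green_equation[OF z] by metis
      also have "\<dots> = delta g x"
        using True g inv_solve_right'[of \<one> x g] by (auto simp: delta_def)
      finally show ?thesis .
    qed (use g in \<open>auto simp: adjacency_def delta_def\<close>)
  qed
qed

lemma resolvent_delta_one:
  assumes "Im z \<noteq> 0" "g \<in> carrier G"
  shows "resolvent z (delta g) \<one> = green z (inv g)"
  using assms by (simp add: resolvent_delta)

lemma green_cnj:
  assumes z: "Im z \<noteq> 0"
  shows "green (cnj z) = (\<lambda>x. cnj (green z x))"
  unfolding green_def[of "cnj z"]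
proof (rule resolvent_eqI)
  show "(\<lambda>x. cnj (green z x)) \<in> ell2 (carrier G)" by (intro ell2_cnj green_ell2 z)
  have "cnj (adjacency (green z) x - z * green z x) = delta \<one> x" for x
    using fun_cong[OF green_equation[OF z], of x] by (simp add: delta_def)
  then show "(\<lambda>x. adjacency (\<lambda>x. cnj (green z x)) x - cnj z * cnj (green z x)) = delta \<one>"
    unfolding adjacency_cnj by (simp add: fun_eq_iff)
qed (use z in simp)

text \<open>The operator \<open>P - z\<close> is symmetric for the bilinear pairing \<open>\<Sum> f h\<close>, hence so is its inverse.\<close>

lemma green_inv:
  assumes z: "Im z \<noteq> 0" and g: "g \<in> carrier G"
  shows "green z (inv g) = green z g"
proof -
  let ?X = "carrier G" and ?r = "resolvent z (delta g)"
  have cz: "Im (cnj z) \<noteq> 0" using z by simp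
  have dg: "delta g \<in> ell2 ?X" by (rule delta_ell2[OF g])
  have "ell2_inner ?X (green (cnj z)) (\<lambda>x. adjacency ?r x - z * ?r x)
      = ell2_inner ?X (\<lambda>x. adjacency (green (cnj z)) x - cnj z * green (cnj z) x) ?r"
    by (rule shifted_adjacency_adjoint[OF green_ell2[OF cz] resolvent_ell2[OF z dg]])
  then have "ell2_inner ?X (green (cnj z)) (delta g) = ell2_inner ?X (delta \<one>) ?r"
    unfolding resolvent_equation[OF z dg] green_equation[OF cz] .
  then show ?thesis
    using z g by (simp add: ell2_inner_delta_left ell2_inner_delta_right green_cnj resolvent_delta_one)
qed

text \<open>The kernel of \<open>\<Im> R\<^sup>z\<close> is real, because \<open>P\<close> has real entries.\<close>

lemma op_kernel_Im_resolvent: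
  assumes z: "Im z \<noteq> 0" and g: "g \<in> carrier G"
  shows "op_kernel (carrier G) (Im_op (carrier G) (resolvent z)) \<one> g = of_real (Im (green z g))"
proof -
  have cz: "Im (cnj z) \<noteq> 0" using z by simp
  have "op_kernel (carrier G) (Im_op (carrier G) (resolvent z)) \<one> g
      = (green z g - cnj (green z g)) / (2 * \<i>)"
    using g by (simp add: op_kernel_def Im_op_def ell2_inner_delta_left adjoint_resolvent[OF z]
        delta_ell2 resolvent_delta_one[OF z] resolvent_delta_one[OF cz] green_inv[OF z]
        green_inv[OF cz] green_cnj[OF z])
  also have "\<dots> = of_real (Im (green z g))"
    by (simp add: complex_eq_iff complex_diff_cnj)
  finally show ?thesis .
qed

text \<open>The Ward identity is the imaginary part of the equation \<open>(P - z) green = \<delta>\<close> paired with the Green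
  function itself.\<close>

lemma ward_identity:
  assumes z: "Im z \<noteq> 0"
  shows "Im z * sqnorm (carrier G) (green z) = Im (green z \<one>)"
  using Im_inner_shifted_adjacency[OF green_ell2[OF z], of z]
  unfolding green_equation[OF z] by (simp add: ell2_inner_delta_right)

text \<open>By the resolvent identity \<open>\<Im> R = \<eta> R\<^sup>* R\<close> is positive, so its entries are bounded by the
  diagonal one.\<close>

lemma abs_Im_green_le:
  assumes z: "Im z > 0" and g: "g \<in> carrier G"
  shows "\<bar>Im (green z g)\<bar> \<le> Im (green z \<one>)"
proof -
  let ?X = "carrier G" and ?r = "resolvent z (delta g)"
  have z0: "Im z \<noteq> 0" using z by simp
  have dg: "delta g \<in> ell2 ?X" by (rule delta_ell2[OF g])
  note e2 = green_ell2[OF z0] resolvent_ell2[OF z0 dg]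
  define c where "c = ell2_inner ?X (green z) ?r"
  have "ell2_inner ?X (green z) (\<lambda>x. adjacency ?r x - z * ?r x)
      = ell2_inner ?X (green z) (\<lambda>x. adjacency ?r x - cnj z * ?r x) - 2 * \<i> * Im z * c"
    unfolding c_def ell2_inner_diff_scaled[OF e2(1) adjacency_ell2[OF e2(2)] e2(2)]
    by (simp add: complex_eq_iff algebra_simps)
  also have "ell2_inner ?X (green z) (\<lambda>x. adjacency ?r x - cnj z * ?r x)
      = ell2_inner ?X (\<lambda>x. adjacency (green z) x - z * green z x) ?r"
    using shifted_adjacency_adjoint[OF e2, of "cnj z"] by simp
  finally have "cnj (green z g) = green z g - 2 * \<i> * Im z * c"
    unfolding green_equation[OF z0] resolvent_equation[OF z0 dg]
    using g by (simp add: ell2_inner_delta_left ell2_inner_delta_right resolvent_delta_one[OF z0] green_inv[OF z0])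
  then have "Im (green z g) = Im z * Re c"
    by (simp add: complex_eq_iff)
  then have "\<bar>Im (green z g)\<bar> \<le> Im z * cmod c"
    using z abs_Re_le_cmod[of c] by (simp add: abs_mult)
  also have "cmod c \<le> (sqnorm ?X (green z) + sqnorm ?X ?r) / 2"
    unfolding c_def by (rule cmod_ell2_inner_le[OF e2])
  also have "sqnorm ?X ?r = sqnorm ?X (green z)"
    unfolding resolvent_delta[OF z0 g]
    by (rule ell2_reindex(2)[OF mult_right_bij e2(1)]) (use g in simp)
  finally show ?thesis using z ward_identity[OF z0] by simp
qed

section \<open>Automorphisms of the Cayley graph\<close>

text \<open>Edges are labelled by generators, and an automorphism of the unlabelled graph may permute the
  labels at each vertex \<open>x\<close> by its own permutation \<open>c\<close>.\<close>

definition cayley_aut :: "('a \<Rightarrow> 'a) \<Rightarrow> bool" where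
  "cayley_aut \<theta> \<longleftrightarrow> bij_betw \<theta> (carrier G) (carrier G) \<and>
     (\<forall>x\<in>carrier G. \<exists>c. bij_betw c S S \<and> (\<forall>s\<in>S. \<theta> (s \<otimes> x) = c s \<otimes> \<theta> x))"

text \<open>Composition with \<open>\<theta>\<close> commutes with \<open>P\<close>, since \<open>\<theta>\<close> permutes the neighbours of a vertex, and the
  Green function is the only solution of its equation.\<close>

lemma green_invariant:
  assumes z: "Im z \<noteq> 0" and \<theta>: "cayley_aut \<theta>" "\<theta> \<one> = \<one>" and x: "x \<in> carrier G"
  shows "green z (\<theta> x) = green z x"
proof -
  let ?X = "carrier G"
  have bij: "bij_betw \<theta> ?X ?X" using \<theta>(1) by (simp add: cayley_aut_def)
  let ?f = "\<lambda>x. if x \<in> ?X then green z (\<theta> x) else 0"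
  have "resolvent z (delta \<one>) = ?f"
  proof (rule resolvent_eqI[OF z])
    show "?f \<in> ell2 ?X" by (rule ell2_reindex(1)[OF bij green_ell2[OF z]])
    show "(\<lambda>x. adjacency ?f x - z * ?f x) = delta \<one>"
    proof
      fix x
      show "adjacency ?f x - z * ?f x = delta \<one> x"
      proof (cases "x \<in> ?X")
        case True
        obtain c where c: "bij_betw c S S" "\<And>s. s \<in> S \<Longrightarrow> \<theta> (s \<otimes> x) = c s \<otimes> \<theta> x"
          using \<theta>(1) True unfolding cayley_aut_def by blast
        have \<theta>x: "\<theta> x \<in> ?X" using bij True by (auto simp: bij_betw_def)
        have "adjacency ?f x = (\<Sum>s\<in>S. green z (c s \<otimes> \<theta> x))"
          using True by (auto simp: adjacency_def c(2) intro!: sum.cong)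
        also have "\<dots> = adjacency (green z) (\<theta> x)"
          using sum.reindex_bij_betw[OF c(1), of "\<lambda>s. green z (s \<otimes> \<theta> x)"] \<theta>x
          by (simp add: adjacency_def)
        finally have "adjacency ?f x - z * ?f x = delta \<one> (\<theta> x)"
          using True fun_cong[OF green_equation[OF z], of "\<theta> x"] by simp
        also have "\<dots> = delta \<one> x"
          using inj_on_eq_iff[OF bij_betw_imp_inj_on[OF bij] True one_closed] \<theta>(2)
          by (simp add: delta_def)
        finally show ?thesis .
      qed (auto simp: adjacency_def delta_def)
    qed
  qed
  then show ?thesis using x fun_cong[of "green z" ?f x] by (simp add: green_def)
qed

end

section \<open>Words in a right-angled Coxeter group\<close>

lemma (in group) eval_word_append:
  assumes "T \<subseteq> carrier G" "u \<in> lists (T \<times> UNIV)" "v \<in> lists (T \<times> UNIV)"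
  shows "eval_word G (u @ v) = eval_word G u \<otimes> eval_word G v"
    and "eval_word G u \<in> carrier G"
proof -
  have closed: "eval_word G u \<in> carrier G" if "u \<in> lists (T \<times> UNIV)" for u
    using that assms(1) by (induction u) (auto simp: eval_word_def)
  then show "eval_word G u \<in> carrier G" using assms(2) by blast
  show "eval_word G (u @ v) = eval_word G u \<otimes> eval_word G v"
    using assms(2)
  proof (induction u)
    case Nil
    then show ?case using closed[OF assms(3)] by (simp add: eval_word_def)
  next
    case (Cons a u)
    obtain t b where a: "a = (t, b)" by (cases a)
    have "t \<in> carrier G" "eval_word G u \<in> carrier G" "eval_word G v \<in> carrier G"
      using Cons.hyps assms(1) closed[OF assms(3)] closed[of u] by (auto simp: a)
    moreover have "eval_word G ((t, b) # x) = (if b then t else inv t) \<otimes> eval_word G x" for x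
      by (simp add: eval_word_def)
    ultimately show ?case using Cons.IH by (simp add: a m_assoc)
  qed
qed

lemma (in group) generate_eval_word:
  assumes T: "T \<subseteq> carrier G" and x: "x \<in> generate G T"
  shows "\<exists>w\<in>lists (T \<times> UNIV). eval_word G w = x"
  using x
proof (induction rule: generate.induct)
  case one
  then show ?case by (intro bexI[of _ "[]"]) (auto simp: eval_word_def)
next
  case (incl h)
  then show ?case using T by (intro bexI[of _ "[(h, True)]"]) (auto simp: eval_word_def)
next
  case (inv h)
  then show ?case using T by (intro bexI[of _ "[(h, False)]"]) (auto simp: eval_word_def)
next
  case (eng h1 h2)
  then obtain u v where uv: "u \<in> lists (T \<times> UNIV)" "v \<in> lists (T \<times> UNIV)"
    "eval_word G u = h1" "eval_word G v = h2" by blast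
  then show ?case using eval_word_append(1)[OF T uv(1,2)] by (intro bexI[of _ "u @ v"]) auto
qed

lemma foldr_closed:
  assumes "\<And>s x. s \<in> S \<Longrightarrow> x \<in> X \<Longrightarrow> A s x \<in> X" "w \<in> lists S" "x \<in> X"
  shows "foldr A w x \<in> X"
  using assms(2) by (induction w) (auto simp: assms)

lemma map_fst_lists: "w \<in> lists (S \<times> UNIV) \<Longrightarrow> map fst w \<in> lists S"
  by (auto simp: lists_eq_set)

locale right_angled_coxeter =
  fixes G :: "('a, 'b) monoid_scheme" (structure) and S :: "'a set" and m :: "'a \<Rightarrow> 'a \<Rightarrow> enat"
  assumes racg: "right_angled_coxeter_group G S m"
begin

lemma presentation: "has_presentation G S (coxeter_relators S m)"
  using racg by (simp add: right_angled_coxeter_group_def)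

lemma
  assumes "s \<in> S"
  shows m_diag: "m s s = 1"
    and m_sym: "t \<in> S \<Longrightarrow> m s t = m t s"
    and m_values: "t \<in> S \<Longrightarrow> m s t = 1 \<or> m s t = 2 \<or> m s t = \<infinity>"
    and m_off_diag: "t \<in> S \<Longrightarrow> s \<noteq> t \<Longrightarrow> m s t \<noteq> 1"
proof -
  have "right_angled_coxeter_matrix S m"
    using racg by (simp add: right_angled_coxeter_group_def)
  note * = this[unfolded right_angled_coxeter_matrix_def]
  show "m s s = 1" "t \<in> S \<Longrightarrow> m s t = m t s" "t \<in> S \<Longrightarrow> m s t = 1 \<or> m s t = 2 \<or> m s t = \<infinity>"
    using * assms by auto
  have "\<not> (2 :: enat) \<le> 1" by (simp add: one_enat_def numeral_eq_enat)
  then show "t \<in> S \<Longrightarrow> s \<noteq> t \<Longrightarrow> m s t \<noteq> 1" using * assms by metis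
qed

lemma coxeter_relator_cases:
  assumes "r \<in> coxeter_relators S m"
  obtains s where "s \<in> S" "r = [(s, True), (s, True)]"
  | s t where "s \<in> S" "t \<in> S" "m s t = 2" "r = [(s, True), (t, True), (s, True), (t, True)]"
proof -
  obtain s t k where k: "r = concat (replicate k [(s, True), (t, True)])"
    "s \<in> S" "t \<in> S" "m s t = enat k"
    using assms by (auto simp: coxeter_relators_def)
  then consider "k = 1" | "k = 2"
    using m_values[OF k(2,3)] by (auto simp: one_enat_def numeral_eq_enat)
  then show thesis
  proof cases
    case 1
    then have "s = t" using m_off_diag[OF k(2,3)] k(4) by (auto simp: one_enat_def)
    with 1 k that(1) show thesis by simp
  next
    case 2
    with k that(2) show thesis by (simp add: numeral_eq_enat numeral_2_eq_2)
  qed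
qed

lemma relator_eval:
  assumes "s \<in> S" "t \<in> S" "m s t = enat k"
  shows "eval_word G (concat (replicate k [(s, True), (t, True)])) = \<one>"
proof -
  let ?r = "concat (replicate k [(s, True), (t, True)])"
  have r: "?r \<in> coxeter_relators S m" "?r \<in> lists (S \<times> UNIV)"
    using assms by (auto simp: coxeter_relators_def lists_eq_set)
  have "presentation_eq S (coxeter_relators S m) ([] @ ?r @ []) ([] @ [])"
    using r by (intro presentation_eq.relator) auto
  then have "eval_word G ?r = eval_word G []"
    using presentation r unfolding has_presentation_def by auto
  then show ?thesis by (simp add: eval_word_def)
qed

sublocale involution_group G S
proof -
  have "group G" using presentation by (simp add: has_presentation_def)
  then interpret group G .
  show "involution_group G S"
  proof
    show "finite S" using racg by (simp add: right_angled_coxeter_group_def)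
    show sub: "S \<subseteq> carrier G" using presentation by (simp add: has_presentation_def)
    fix s assume s: "s \<in> S"
    then have "s \<in> carrier G" using sub by auto
    then show "s \<otimes> s = \<one>"
      using relator_eval[OF s s, of 1] m_diag[OF s] by (simp add: eval_word_def one_enat_def)
  qed
qed

definition ev :: "'a list \<Rightarrow> 'a" where
  "ev w = foldr (\<otimes>) w \<one>"

lemma ev_Nil [simp]: "ev [] = \<one>"
  and ev_Cons [simp]: "ev (s # w) = s \<otimes> ev w"
  by (simp_all add: ev_def)

lemma ev_closed [simp]: "w \<in> lists S \<Longrightarrow> ev w \<in> carrier G"
  by (induction w) auto

lemma ev_append: "u \<in> lists S \<Longrightarrow> v \<in> lists S \<Longrightarrow> ev (u @ v) = ev u \<otimes> ev v"
  by (induction u) (auto simp: m_assoc)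

lemma ev_rev: "w \<in> lists S \<Longrightarrow> ev (rev w) = inv (ev w)"
  by (induction w) (simp_all add: ev_append inv_mult_group S_inv in_lists_conv_set)

lemma eval_word_eq_ev: "w \<in> lists (S \<times> UNIV) \<Longrightarrow> eval_word G w = ev (map fst w)"
  by (induction w) (auto simp: eval_word_def S_inv)

lemma word_exists: "x \<in> carrier G \<Longrightarrow> \<exists>w\<in>lists S. ev w = x"
proof -
  assume "x \<in> carrier G"
  then have "x \<in> eval_word G ` lists (S \<times> UNIV)"
    using presentation by (simp add: has_presentation_def)
  then obtain w where w: "w \<in> lists (S \<times> UNIV)" "x = eval_word G w" by (rule imageE)
  then show ?thesis using map_fst_lists[OF w(1)] eval_word_eq_ev[OF w(1)] by metis
qed

lemma S_commute_of_m_eq_2: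
  assumes "s \<in> S" "t \<in> S" "m s t = 2"
  shows "s \<otimes> t = t \<otimes> s"
proof -
  have "s \<otimes> (t \<otimes> (s \<otimes> t)) = \<one>"
    using relator_eval[OF assms(1,2), of 2] assms
    by (simp add: eval_word_def numeral_eq_enat numeral_2_eq_2)
  then have "t \<otimes> (s \<otimes> (s \<otimes> (t \<otimes> (s \<otimes> t)))) = t \<otimes> (s \<otimes> \<one>)" by simp
  then show ?thesis using assms by simp
qed

text \<open>The universal property of the presentation, in the form in which it is used: involutions indexed
  by \<open>S\<close> that commute wherever the generators do define an action of the group.\<close>

lemma action_well_defined:
  assumes closed: "\<And>s x. s \<in> S \<Longrightarrow> x \<in> X \<Longrightarrow> A s x \<in> X"
    and inv: "\<And>s x. s \<in> S \<Longrightarrow> x \<in> X \<Longrightarrow> A s (A s x) = x"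
    and comm: "\<And>s t x. s \<in> S \<Longrightarrow> t \<in> S \<Longrightarrow> m s t = 2 \<Longrightarrow> x \<in> X \<Longrightarrow> A s (A t x) = A t (A s x)"
    and words: "v \<in> lists S" "w \<in> lists S" "ev v = ev w" and x: "x \<in> X"
  shows "foldr A v x = foldr A w x"
proof -
  let ?f = "\<lambda>w. foldr A (map fst w)"
  have pres: "\<forall>x\<in>X. ?f v x = ?f w x" if "presentation_eq S (coxeter_relators S m) v w" for v w
    using that
  proof (induction rule: presentation_eq.induct)
    case (cancel u v s b)
    then show ?case
      by (auto simp: inv foldr_closed[where A = A and X = X, OF closed map_fst_lists])
  next
    case (relator u v r)
    have v: "?f v x \<in> X" if "x \<in> X" for x
      using foldr_closed[where A = A and X = X, OF closed map_fst_lists[OF relator(2)] that] .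
    from relator(3) show ?case
    proof (cases rule: coxeter_relator_cases)
      case (1 s)
      then show ?thesis by (simp add: inv v)
    next
      case (2 s t)
      then have "A s (A t (A s (A t y))) = y" if "y \<in> X" for y
        using that comm[of s t "A s (A t y)"] by (simp add: inv closed comm)
      with 2 show ?thesis by (simp add: v)
    qed
  qed auto
  let ?s = "map (\<lambda>s. (s, True))"
  have s: "?s u \<in> lists (S \<times> UNIV)" "map fst (?s u) = u" if "u \<in> lists S" for u
    using that by (auto simp: lists_eq_set comp_def)
  have "eval_word G (?s v) = eval_word G (?s w)"
    using words s by (simp add: eval_word_eq_ev)
  then have "presentation_eq S (coxeter_relators S m) (?s v) (?s w)"
    using presentation s words unfolding has_presentation_def by metis
  then show ?thesis using pres x s words by metis
qed

subsection \<open>Geodesic words\<close>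

definition geodesic :: "'a list \<Rightarrow> bool" where
  "geodesic w \<longleftrightarrow> w \<in> lists S \<and> (\<forall>v\<in>lists S. ev v = ev w \<longrightarrow> length w \<le> length v)"

lemma geodesic_lists: "geodesic w \<Longrightarrow> w \<in> lists S"
  by (simp add: geodesic_def)

lemma geodesic_le:
  "geodesic w \<Longrightarrow> v \<in> lists S \<Longrightarrow> ev v = ev w \<Longrightarrow> length w \<le> length v"
  by (simp add: geodesic_def)

lemma geodesic_exists:
  assumes "x \<in> carrier G"
  obtains w where "geodesic w" "ev w = x"
proof -
  define W where "W = {w \<in> lists S. ev w = x}"
  have "W \<noteq> {}" using word_exists[OF assms] by (auto simp: W_def)
  then obtain w where "w \<in> W" "\<forall>v\<in>W. length w \<le> length v"
    using ex_has_least_nat[of "\<lambda>w. w \<in> W" _ length] by blast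
  then show ?thesis using that[of w] by (auto simp: W_def geodesic_def)
qed

lemma geodesic_infix:
  assumes "geodesic (u @ v @ w)"
  shows "geodesic v"
  unfolding geodesic_def
proof (intro conjI ballI impI)
  have l: "u \<in> lists S" "v \<in> lists S" "w \<in> lists S" using geodesic_lists[OF assms] by auto
  then show "v \<in> lists S" by simp
  fix v' assume v': "v' \<in> lists S" "ev v' = ev v"
  then have "ev (u @ v' @ w) = ev (u @ v @ w)" using l by (simp add: ev_append)
  then show "length v \<le> length v'"
    using geodesic_le[OF assms, of "u @ v' @ w"] l v' by simp
qed

lemma geodesic_prefix: "geodesic (u @ v) \<Longrightarrow> geodesic u"
  and geodesic_suffix: "geodesic (u @ v) \<Longrightarrow> geodesic v"
  using geodesic_infix[of "[]" u v] geodesic_infix[of u v "[]"] by auto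

lemma geodesic_rev:
  assumes "geodesic w" shows "geodesic (rev w)"
  unfolding geodesic_def
proof (intro conjI ballI impI)
  have w: "w \<in> lists S" by (rule geodesic_lists[OF assms])
  then show "rev w \<in> lists S" by (auto simp: lists_eq_set)
  fix v assume v: "v \<in> lists S" "ev v = ev (rev w)"
  then have rv: "rev v \<in> lists S" by (auto simp: lists_eq_set)
  have "ev (rev v) = ev w" using v w by (simp add: ev_rev)
  then show "length (rev w) \<le> length v" using geodesic_le[OF assms rv] by simp
qed

lemma geodesic_no_return:
  assumes "geodesic (s # c @ [s])"
  shows "s \<otimes> ev c \<noteq> ev c \<otimes> s"
proof
  assume eq: "s \<otimes> ev c = ev c \<otimes> s"
  have l: "s \<in> S" "c \<in> lists S" using geodesic_lists[OF assms] by auto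
  have "ev (s # c @ [s]) = ev c" using l eq by (simp add: ev_append flip: eq)
  then show False using geodesic_le[OF assms l(2)] by simp
qed

definition star :: "'a \<Rightarrow> 'a set" where
  "star s = insert s (neighbors S m s)"

lemma star_subset: "s \<in> S \<Longrightarrow> star s \<subseteq> S"
  by (auto simp: star_def neighbors_def)

lemma star_commute: "s \<in> S \<Longrightarrow> t \<in> star s \<Longrightarrow> s \<otimes> t = t \<otimes> s"
  using S_commute_of_m_eq_2 by (auto simp: star_def neighbors_def)

lemma not_commuting_imp_m: "s \<in> S \<Longrightarrow> t \<in> S \<Longrightarrow> \<not> commuting G s t \<Longrightarrow> t \<notin> star s"
  using star_commute by (auto simp: commuting_def)

definition star_group :: "'a \<Rightarrow> 'a set" where
  "star_group s = ev ` lists (star s)"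

lemma commute_ev:
  assumes s: "s \<in> S" and w: "w \<in> lists S" and comm: "\<And>t. t \<in> set w \<Longrightarrow> s \<otimes> t = t \<otimes> s"
  shows "s \<otimes> ev w = ev w \<otimes> s"
  using w comm
proof (induction w)
  case (Cons t w)
  have w: "w \<in> lists S" "t \<in> S" using Cons.hyps by auto
  have "s \<otimes> (t \<otimes> ev w) = t \<otimes> (s \<otimes> ev w)"
    using s w Cons.prems[of t] by (simp flip: m_assoc)
  also have "\<dots> = t \<otimes> ev w \<otimes> s" using Cons s w by (simp add: m_assoc)
  finally show ?case by simp
qed (use s in auto)

lemma star_group_commute:
  assumes s: "s \<in> S" and x: "x \<in> star_group s"
  shows "s \<otimes> x = x \<otimes> s"
proof -
  obtain w where w: "x = ev w" "w \<in> lists (star s)"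
    using x unfolding star_group_def by (rule imageE)
  have "s \<otimes> ev w = ev w \<otimes> s"
  proof (rule commute_ev[OF s])
    show "w \<in> lists S" using w(2) star_subset[OF s] by auto
    show "s \<otimes> t = t \<otimes> s" if "t \<in> set w" for t
      using w(2) that star_commute[OF s] by auto
  qed
  then show ?thesis by (simp add: w(1))
qed

lemma star_group_mult_iff:
  assumes s: "s \<in> S" and t: "t \<in> star s" and x: "x \<in> carrier G"
  shows "t \<otimes> x \<in> star_group s \<longleftrightarrow> x \<in> star_group s"
proof -
  have mult: "t \<otimes> y \<in> star_group s" if "y \<in> star_group s" for y
    using that t unfolding star_group_def by (auto intro!: image_eqI[where x = "t # _"])
  have "t \<in> S" using star_subset[OF s] t by auto
  then show ?thesis using mult[of x] mult[of "t \<otimes> x"] x by auto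
qed

text \<open>Deleting the letters outside \<open>K\<close> is a retraction of the group onto the subgroup generated by
  \<open>K\<close>; on an element of this subgroup it shortens every word that has such letters.\<close>

lemma geodesic_special_subgroup:
  assumes K: "K \<subseteq> S" and w: "geodesic w" and v: "v \<in> lists K" "ev v = ev w"
  shows "set w \<subseteq> K"
proof -
  let ?A = "\<lambda>s x. if s \<in> K then s \<otimes> x else x"
  have fold: "foldr ?A u \<one> = ev (filter (\<lambda>s. s \<in> K) u)" if "u \<in> lists S" for u
    using that by (induction u) auto
  have vS: "v \<in> lists S" using v(1) K by auto
  have "foldr ?A v \<one> = foldr ?A w \<one>"
  proof (rule action_well_defined[where X = "carrier G"])
    fix s t x assume st: "s \<in> S" "t \<in> S" "m s t = 2" "x \<in> carrier G"
    then show "?A s (?A t x) = ?A t (?A s x)"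
      using S_commute_of_m_eq_2[of s t] by (simp flip: m_assoc)
  qed (use v geodesic_lists[OF w] vS in auto)
  moreover have "filter (\<lambda>s. s \<in> K) v = v" using v(1) by (auto simp: filter_id_conv lists_eq_set)
  ultimately have "ev (filter (\<lambda>s. s \<in> K) w) = ev w"
    using fold[OF vS] fold[OF geodesic_lists[OF w]] v(2) by simp
  moreover have "filter (\<lambda>s. s \<in> K) w \<in> lists S" using geodesic_lists[OF w] by auto
  ultimately have "length w \<le> length (filter (\<lambda>s. s \<in> K) w)"
    by (intro geodesic_le[OF w])
  then show ?thesis
    by (metis filter_id_conv length_filter_less linorder_not_less subsetI)
qed

subsection \<open>Walls\<close>

text \<open>The wall of a generator \<open>s\<close> consists of the edges \<open>{x, s x}\<close> with \<open>x\<close> in the star group of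
  \<open>s\<close>. A word \<open>w = t\<^sub>n \<dots> t\<^sub>1\<close> is read as the path from \<open>\<one>\<close> through the suffixes of \<open>w\<close>, and
  \<open>crossing s w\<close> is the parity of the number of times that this path crosses the wall.\<close>

fun crossing :: "'a \<Rightarrow> 'a list \<Rightarrow> bool" where
  "crossing s [] = False"
| "crossing s (t # w) = (crossing s w \<noteq> (t = s \<and> ev w \<in> star_group s))"

text \<open>The generators act on pairs of a group element and a parity. The relation \<open>s s = \<one>\<close> crosses
  the same edge twice, and in a square spanned by commuting generators \<open>s\<close> and \<open>t\<close> the two edges with
  label \<open>s\<close> are both in the wall or both outside it.\<close>

lemma crossing_well_defined:
  assumes s: "s \<in> S" and vw: "v \<in> lists S" "w \<in> lists S" "ev v = ev w"
  shows "crossing s v = crossing s w"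
proof -
  let ?A = "\<lambda>t (x, b). (t \<otimes> x, b \<noteq> (t = s \<and> x \<in> star_group s))"
  have fold: "foldr ?A u (\<one>, False) = (ev u, crossing s u)" for u
    by (induction u) auto
  have "foldr ?A v (\<one>, False) = foldr ?A w (\<one>, False)"
  proof (rule action_well_defined[where X = "carrier G \<times> UNIV"])
    fix t y assume "t \<in> S" "y \<in> carrier G \<times> (UNIV :: bool set)"
    then show "?A t (?A t y) = y"
      using star_group_mult_iff[OF s, of s "fst y"] by (auto simp: star_def split: prod.splits)
  next
    fix t u y assume tu: "t \<in> S" "u \<in> S" "m t u = 2" and y: "y \<in> carrier G \<times> (UNIV :: bool set)"
    have "t \<noteq> u" using tu m_diag[of t] by auto
    moreover have "u \<otimes> fst y \<in> star_group s \<longleftrightarrow> fst y \<in> star_group s" if "t = s"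
      using that tu y \<open>t \<noteq> u\<close> star_group_mult_iff[OF s, of u "fst y"]
      by (auto simp: star_def neighbors_def)
    moreover have "t \<otimes> fst y \<in> star_group s \<longleftrightarrow> fst y \<in> star_group s" if "u = s"
      using that tu y \<open>t \<noteq> u\<close> m_sym[of t s] star_group_mult_iff[OF s, of t "fst y"]
      by (auto simp: star_def neighbors_def)
    moreover have "t \<otimes> (u \<otimes> fst y) = u \<otimes> (t \<otimes> fst y)"
      using tu y S_commute_of_m_eq_2[of t u] by (auto simp flip: m_assoc)
    ultimately show "?A t (?A u y) = ?A u (?A t y)"
      by (auto split: prod.splits)
  qed (use vw in auto)
  then show ?thesis unfolding fold by simp
qed

lemma crossing_imp_edge:
  "crossing s w \<Longrightarrow> \<exists>w1 w2. w = w1 @ s # w2 \<and> ev w2 \<in> star_group s"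
proof (induction w)
  case (Cons t w)
  show ?case
  proof (cases "t = s \<and> ev w \<in> star_group s")
    case True
    then show ?thesis by blast
  next
    case False
    then have "crossing s w" using Cons.prems by simp
    then obtain w1 w2 where "w = w1 @ s # w2" "ev w2 \<in> star_group s" using Cons.IH by blast
    then show ?thesis by (metis append_Cons)
  qed
qed simp

text \<open>A geodesic crosses each wall at most once: the part between two crossings of the wall of \<open>s\<close> would
  commute with \<open>s\<close>, and the two letters \<open>s\<close> would cancel. Hence the wall crossed by one step of a
  geodesic is crossed neither later nor earlier.\<close>

lemma geodesic_crossing_first_edge:
  assumes "geodesic (w @ [s])"
  shows "crossing s (w @ [s])"
  using assms
proof (induction w)
  case Nil
  have "\<one> \<in> star_group s" unfolding star_group_def by (rule image_eqI[where x = "[]"]) auto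
  then show ?case by simp
next
  case (Cons t w)
  have g: "geodesic (w @ [s])" using Cons.prems geodesic_suffix[of "[t]" "w @ [s]"] by simp
  have l: "w \<in> lists S" "s \<in> S" using geodesic_lists[OF g] by auto
  have "\<not> (t = s \<and> ev (w @ [s]) \<in> star_group s)"
  proof
    assume t: "t = s \<and> ev (w @ [s]) \<in> star_group s"
    then have "s \<otimes> ev (w @ [s]) = ev (w @ [s]) \<otimes> s" using star_group_commute l by blast
    then have "ev (t # w @ [s]) = ev w" using t l S_involution by (simp add: ev_append m_assoc)
    then show False using geodesic_le[OF Cons.prems, of w] l by simp
  qed
  then show ?case using Cons.IH[OF g] by simp
qed

lemma geodesic_crossing_behind:
  assumes "geodesic (s # w)"
  shows "\<not> crossing s (rev w)"
proof
  assume "crossing s (rev w)"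
  then obtain w1 w2 where w: "rev w = w1 @ s # w2" "ev w2 \<in> star_group s"
    using crossing_imp_edge by blast
  have "rev (s # w) = w1 @ (s # w2 @ [s])" using w(1) by simp
  then have "geodesic (s # w2 @ [s])" using geodesic_rev[OF assms] geodesic_suffix by metis
  moreover have "s \<in> S" using geodesic_lists[OF assms] by simp
  ultimately show False using geodesic_no_return star_group_commute w(2) by blast
qed

text \<open>The exchange property: a step that can be made first can be commuted there. The word \<open>w\<close> has to
  cross the wall of \<open>t\<close> as the word \<open>v t\<close> does, and what precedes the crossing lies in the star group,
  where geodesic words only use letters of the star.\<close>

lemma geodesic_exchange:
  assumes w: "geodesic w" and v: "geodesic (v @ [t])" and eq: "ev w = ev (v @ [t])"
  obtains w1 w2 where "w = w1 @ t # w2" "set w2 \<subseteq> neighbors S m t"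
proof -
  have t: "t \<in> S" using geodesic_lists[OF v] by simp
  have "crossing t w"
    using geodesic_crossing_first_edge[OF v] crossing_well_defined[OF t] eq
      geodesic_lists[OF v] geodesic_lists[OF w] by blast
  then obtain w1 w2 where w12: "w = w1 @ t # w2" "ev w2 \<in> star_group t"
    using crossing_imp_edge by blast
  have "geodesic w2" using w geodesic_suffix[of "w1 @ [t]" w2] w12(1) by simp
  then have sub: "set w2 \<subseteq> star t"
  proof -
    obtain u where u: "u \<in> lists (star t)" "ev w2 = ev u"
      using w12(2) unfolding star_group_def by (rule imageE)
    show ?thesis by (rule geodesic_special_subgroup[OF star_subset[OF t] \<open>geodesic w2\<close> u(1) u(2)[symmetric]])
  qed
  have "t \<notin> set w2"
  proof
    assume "t \<in> set w2"
    then obtain c d where cd: "w2 = c @ t # d" by (meson split_list)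
    have "geodesic (t # c @ [t])"
      using w geodesic_infix[of w1 "t # c @ [t]" d] unfolding w12(1) cd by simp
    moreover have "ev c \<in> star_group t" using sub unfolding star_group_def cd by auto
    ultimately show False using geodesic_no_return star_group_commute[OF t] by blast
  qed
  then show thesis using that w12(1) sub by (auto simp: star_def)
qed

text \<open>Two geodesic words for the same element differ by commutations, which do not affect the
  subword in two letters that do not commute. The exchange property provides these commutations, one
  letter at a time.\<close>

lemma geodesic_filter_unique:
  assumes "geodesic v" "geodesic w" "ev v = ev w"
    and tu: "t \<in> S" "u \<in> S" "\<not> commuting G t u"
  shows "filter (\<lambda>x. x \<in> {t, u}) v = filter (\<lambda>x. x \<in> {t, u}) w"
  using assms(1-3)
proof (induction v arbitrary: w rule: rev_induct)
  case Nil
  have "length w \<le> length ([] :: 'a list)" by (rule geodesic_le[OF Nil(2) _ Nil(3)]) simp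
  then show ?case by simp
next
  case (snoc a v)
  obtain w1 w2 where w: "w = w1 @ a # w2" and nbr: "set w2 \<subseteq> neighbors S m a"
    using geodesic_exchange[OF snoc.prems(2,1) snoc.prems(3)[symmetric]] .
  have l: "v \<in> lists S" "a \<in> S" "w1 \<in> lists S" "w2 \<in> lists S"
    using geodesic_lists[OF snoc.prems(1)] geodesic_lists[OF snoc.prems(2)] w by auto
  have "ev w2 \<in> star_group a" using nbr unfolding star_group_def star_def by (auto simp: lists_eq_set)
  then have "a \<otimes> ev w2 = ev w2 \<otimes> a" by (rule star_group_commute[OF l(2)])
  then have "ev w = ev (w1 @ w2) \<otimes> a" using l by (simp add: w ev_append m_assoc)
  then have eq: "ev v = ev (w1 @ w2)" using snoc.prems(3) l by (simp add: ev_append)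
  have gv: "geodesic v" by (rule geodesic_prefix[OF snoc.prems(1)])
  have len: "length (w1 @ w2) = length v"
  proof -
    have "length (v @ [a]) = length w"
      using geodesic_le[OF snoc.prems(1) geodesic_lists[OF snoc.prems(2)]]
        geodesic_le[OF snoc.prems(2) geodesic_lists[OF snoc.prems(1)]] snoc.prems(3) by simp
    then show ?thesis by (simp add: w)
  qed
  have "geodesic (w1 @ w2)"
    using gv l len eq unfolding geodesic_def by simp
  then have IH: "filter (\<lambda>x. x \<in> {t, u}) v = filter (\<lambda>x. x \<in> {t, u}) (w1 @ w2)"
    using snoc.IH[OF gv _ eq] by blast
  have "filter (\<lambda>x. x \<in> {t, u}) w2 = []" if "a \<in> {t, u}"
  proof -
    have "u \<notin> star t" "t \<notin> star u"
      using not_commuting_imp_m[OF tu] not_commuting_imp_m[OF tu(2,1)] tu(3)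
      by (auto simp: commuting_def)
    then have "x \<notin> {t, u}" if "x \<in> set w2" for x
      using nbr that \<open>a \<in> {t, u}\<close> by (auto simp: star_def neighbors_def)
    then show ?thesis by (simp add: filter_empty_conv)
  qed
  with IH show ?case by (auto simp: w)
qed

section \<open>Bending the Cayley graph along a wall\<close>

context
  fixes \<phi>
  assumes \<phi>: "diagram_automorphism S m \<phi>"
begin

lemma diagram_automorphism_closed [simp]: "s \<in> S \<Longrightarrow> \<phi> s \<in> S"
  using \<phi> by (auto simp: diagram_automorphism_def bij_betw_def)

lemma diagram_automorphism_eq_iff: "s \<in> S \<Longrightarrow> t \<in> S \<Longrightarrow> \<phi> s = \<phi> t \<longleftrightarrow> s = t"
  using \<phi> by (auto simp: diagram_automorphism_def bij_betw_def inj_on_eq_iff)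

lemma map_lists_closed: "w \<in> lists S \<Longrightarrow> map \<phi> w \<in> lists S"
  by (simp add: in_lists_conv_set)

lemma diagram_automorphism_inv: "diagram_automorphism S m (inv_into S \<phi>)"
  unfolding diagram_automorphism_def
proof (intro conjI ballI)
  have bij: "bij_betw \<phi> S S" using \<phi> by (simp add: diagram_automorphism_def)
  show "bij_betw (inv_into S \<phi>) S S" by (rule bij_betw_inv_into[OF bij])
  fix s t assume st: "s \<in> S" "t \<in> S"
  let ?s = "inv_into S \<phi> s" and ?t = "inv_into S \<phi> t"
  have "?s \<in> S" "?t \<in> S" "\<phi> ?s = s" "\<phi> ?t = t"
    using st bij by (auto simp: bij_betw_def inv_into_into f_inv_into_f)
  then show "t \<in> neighbors S m s \<longleftrightarrow> ?t \<in> neighbors S m ?s"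
    using \<phi> unfolding diagram_automorphism_def by metis
qed

lemma ev_map_cong:
  assumes "v \<in> lists S" "w \<in> lists S" "ev v = ev w"
  shows "ev (map \<phi> v) = ev (map \<phi> w)"
proof -
  have fold: "foldr (\<lambda>s x. \<phi> s \<otimes> x) u \<one> = ev (map \<phi> u)" for u
    by (induction u) auto
  have "foldr (\<lambda>s x. \<phi> s \<otimes> x) v \<one> = foldr (\<lambda>s x. \<phi> s \<otimes> x) w \<one>"
  proof (rule action_well_defined[where X = "carrier G"])
    fix s t x assume st: "s \<in> S" "t \<in> S" "m s t = 2" and x: "x \<in> carrier G"
    have "s \<noteq> t" using st m_diag[of s] by auto
    then have "\<phi> t \<in> neighbors S m (\<phi> s)"
      using st \<phi> unfolding diagram_automorphism_def neighbors_def by blast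
    then have "\<phi> s \<otimes> \<phi> t = \<phi> t \<otimes> \<phi> s"
      using st by (intro S_commute_of_m_eq_2) (auto simp: neighbors_def)
    then show "\<phi> s \<otimes> (\<phi> t \<otimes> x) = \<phi> t \<otimes> (\<phi> s \<otimes> x)"
      using st x by (simp flip: m_assoc)
  qed (use assms in auto)
  then show ?thesis unfolding fold .
qed

end

lemma ev_map_inj:
  assumes \<phi>: "diagram_automorphism S m \<phi>"
    and vw: "v \<in> lists S" "w \<in> lists S" "ev (map \<phi> v) = ev (map \<phi> w)"
  shows "ev v = ev w"
proof -
  have inv: "map (inv_into S \<phi>) (map \<phi> u) = u" if "u \<in> lists S" for u
    using that \<phi> by (auto simp: diagram_automorphism_def bij_betw_def in_lists_conv_set map_idI)
  have "ev (map (inv_into S \<phi>) (map \<phi> v)) = ev (map (inv_into S \<phi>) (map \<phi> w))"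
    by (rule ev_map_cong[OF diagram_automorphism_inv[OF \<phi>]
        map_lists_closed[OF \<phi> vw(1)] map_lists_closed[OF \<phi> vw(2)] vw(3)])
  then show ?thesis by (simp only: inv vw)
qed

text \<open>The automorphism of the group induced by an automorphism of the diagram, and the side of the wall
  of \<open>s\<close> on which an element lies, each computed from an arbitrary word.\<close>

definition word_of :: "'a \<Rightarrow> 'a list" where
  "word_of x = (SOME w. w \<in> lists S \<and> ev w = x)"

lemma word_of:
  assumes "x \<in> carrier G"
  shows "word_of x \<in> lists S" "ev (word_of x) = x"
  using someI_ex[of "\<lambda>w. w \<in> lists S \<and> ev w = x"] word_exists[OF assms]
  unfolding word_of_def by blast+

definition diagram_hom :: "('a \<Rightarrow> 'a) \<Rightarrow> 'a \<Rightarrow> 'a" where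
  "diagram_hom \<phi> x = ev (map \<phi> (word_of x))"

definition beyond_wall :: "'a \<Rightarrow> 'a \<Rightarrow> bool" where
  "beyond_wall s x = crossing s (word_of x)"

lemma diagram_hom_ev:
  "diagram_automorphism S m \<phi> \<Longrightarrow> w \<in> lists S \<Longrightarrow> diagram_hom \<phi> (ev w) = ev (map \<phi> w)"
  unfolding diagram_hom_def by (intro ev_map_cong) (auto simp: word_of)

lemma beyond_wall_ev: "s \<in> S \<Longrightarrow> w \<in> lists S \<Longrightarrow> beyond_wall s (ev w) = crossing s w"
  unfolding beyond_wall_def by (intro crossing_well_defined) (auto simp: word_of)

definition fixes_star :: "'a \<Rightarrow> ('a \<Rightarrow> 'a) \<Rightarrow> bool" where
  "fixes_star s \<phi> \<longleftrightarrow> diagram_automorphism S m \<phi> \<and> (\<forall>v\<in>star s. \<phi> v = v)"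

lemma fixes_star_imp: "fixes_star s \<phi> \<Longrightarrow> diagram_automorphism S m \<phi>"
  by (simp add: fixes_star_def)

lemma fixes_star_word:
  assumes "fixes_star s \<phi>" "w \<in> lists (star s)"
  shows "map \<phi> w = w"
  using assms by (intro map_idI) (auto simp: fixes_star_def in_lists_conv_set)

lemma star_group_map_iff:
  assumes s: "s \<in> S" and \<phi>: "fixes_star s \<phi>" and w: "w \<in> lists S"
  shows "ev (map \<phi> w) \<in> star_group s \<longleftrightarrow> ev w \<in> star_group s"
proof -
  note aut = fixes_star_imp[OF \<phi>]
  have "ev (map \<phi> w) = ev v \<longleftrightarrow> ev w = ev v" if "v \<in> lists (star s)" for v
  proof -
    have "v \<in> lists S" using that star_subset[OF s] by auto
    then show ?thesis
      using ev_map_inj[OF aut w, of v] ev_map_cong[OF aut w, of v] fixes_star_word[OF \<phi> that]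
      by metis
  qed
  then show ?thesis unfolding star_group_def by blast
qed

lemma crossing_map:
  assumes s: "s \<in> S" and \<phi>: "fixes_star s \<phi>" and w: "w \<in> lists S"
  shows "crossing s (map \<phi> w) = crossing s w"
  using w
proof (induction w)
  case (Cons t w)
  have "\<phi> s = s" using \<phi> by (simp add: fixes_star_def star_def)
  moreover have t: "t \<in> S" "w \<in> lists S" using Cons.hyps by auto
  ultimately have "\<phi> t = s \<longleftrightarrow> t = s"
    using diagram_automorphism_eq_iff[OF fixes_star_imp[OF \<phi>] t(1) s] by simp
  then show ?case using Cons.IH star_group_map_iff[OF s \<phi> t(2)] by simp
qed simp

text \<open>The bending map: the graph is cut along the wall of \<open>s\<close>, the automorphism \<open>\<phi>\<close> is applied to the
  side away from \<open>\<one>\<close>, and the sides are glued again, which is possible because \<open>\<phi>\<close> fixes the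
  vertices along the wall.\<close>

definition bend :: "'a \<Rightarrow> ('a \<Rightarrow> 'a) \<Rightarrow> 'a \<Rightarrow> 'a" where
  "bend s \<phi> x = (if beyond_wall s x then diagram_hom \<phi> x else x)"

lemma bend_ev:
  assumes "s \<in> S" "fixes_star s \<phi>" "w \<in> lists S"
  shows "bend s \<phi> (ev w) = ev (if crossing s w then map \<phi> w else w)"
  using assms by (simp add: bend_def beyond_wall_ev diagram_hom_ev fixes_star_imp)

lemma bend_aut:
  assumes s: "s \<in> S" and \<phi>: "fixes_star s \<phi>"
  shows "cayley_aut (bend s \<phi>)"
  unfolding cayley_aut_def
proof (intro conjI ballI)
  note aut = fixes_star_imp[OF \<phi>]
  let ?b = "\<lambda>w. if crossing s w then map \<phi> w else w"
  have b: "?b w \<in> lists S" "crossing s (?b w) = crossing s w" if "w \<in> lists S" for w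
    by (cases "crossing s w"; simp add: that crossing_map[OF s \<phi> that] map_lists_closed[OF aut that])+
  show "bij_betw (bend s \<phi>) (carrier G) (carrier G)"
    unfolding bij_betw_def
  proof
    show "inj_on (bend s \<phi>) (carrier G)"
    proof (rule inj_onI)
      fix x y assume xy: "x \<in> carrier G" "y \<in> carrier G" and eq: "bend s \<phi> x = bend s \<phi> y"
      obtain v w where vw: "v \<in> lists S" "x = ev v" "w \<in> lists S" "y = ev w"
        using word_exists xy by metis
      have eq': "ev (?b v) = ev (?b w)" using eq vw by (simp add: bend_ev[OF s \<phi>])
      then have "crossing s v = crossing s w"
        using crossing_well_defined[OF s b(1)[OF vw(1)] b(1)[OF vw(3)] eq'] b(2) vw by simp
      then show "x = y" using eq' ev_map_inj[OF aut vw(1,3)] vw(2,4) by (auto split: if_splits)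
    qed
    show "bend s \<phi> ` carrier G = carrier G"
    proof
      show "bend s \<phi> ` carrier G \<subseteq> carrier G"
      proof
        fix y assume "y \<in> bend s \<phi> ` carrier G"
        then obtain x where "x \<in> carrier G" "y = bend s \<phi> x" by blast
        moreover from this(1) obtain w where "w \<in> lists S" "x = ev w" using word_exists by blast
        ultimately show "y \<in> carrier G" using b(1) by (simp add: bend_ev[OF s \<phi>])
      qed
      show "carrier G \<subseteq> bend s \<phi> ` carrier G"
      proof
        fix y assume "y \<in> carrier G"
        then obtain w where w: "w \<in> lists S" "y = ev w" using word_exists by metis
        let ?w = "map (inv_into S \<phi>) w"
        have img: "\<phi> ` S = S" using aut by (simp add: diagram_automorphism_def bij_betw_def)
        have "map \<phi> ?w = map (\<phi> \<circ> inv_into S \<phi>) w" by simp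
        also have "\<dots> = w"
          by (rule map_idI) (use w(1) img in \<open>simp add: in_lists_conv_set f_inv_into_f\<close>)
        finally have w': "?w \<in> lists S" "map \<phi> ?w = w"
          using map_lists_closed[OF diagram_automorphism_inv[OF aut] w(1)] by simp_all
        have "crossing s ?w = crossing s w" using crossing_map[OF s \<phi> w'(1)] w'(2) by simp
        then have "bend s \<phi> (ev (if crossing s w then ?w else w)) = y"
          using w w' by (simp add: bend_ev[OF s \<phi>])
        moreover have "ev (if crossing s w then ?w else w) \<in> carrier G" using w w' by simp
        ultimately show "y \<in> bend s \<phi> ` carrier G" by blast
      qed
    qed
  qed
  fix x assume "x \<in> carrier G"
  then obtain w where w: "w \<in> lists S" "x = ev w" using word_exists by metis
  have step: "bend s \<phi> (t \<otimes> x) = (if crossing s w then \<phi> else id) t \<otimes> bend s \<phi> x" if t: "t \<in> S" for t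
  proof -
    have tx: "bend s \<phi> (t \<otimes> x) = ev (?b (t # w))"
      using bend_ev[OF s \<phi>, of "t # w"] t w by simp
    show ?thesis
    proof (cases "t = s \<and> ev w \<in> star_group s")
      case True
      then obtain v where v: "v \<in> lists (star s)" "ev w = ev v" by (auto simp: star_group_def)
      then have vS: "v \<in> lists S" using star_subset[OF s] by auto
      have "ev (map \<phi> w) = ev w"
        using ev_map_cong[OF aut w(1) vS v(2)] fixes_star_word[OF \<phi> v(1)] v(2) by simp
      moreover have "\<phi> s = s" using \<phi> by (simp add: fixes_star_def star_def)
      ultimately show ?thesis using True w unfolding tx by (simp add: bend_ev[OF s \<phi>])
    next
      case False
      then have "crossing s (t # w) = crossing s w" by auto
      then show ?thesis using w unfolding tx by (simp add: bend_ev[OF s \<phi>] del: crossing.simps)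
    qed
  qed
  have "bij_betw (if crossing s w then \<phi> else id) S S"
    using aut by (simp add: diagram_automorphism_def)
  with step show "\<exists>c. bij_betw c S S \<and> (\<forall>t\<in>S. bend s \<phi> (t \<otimes> x) = c t \<otimes> bend s \<phi> x)" by blast
qed

lemma cayley_aut_closed: "cayley_aut \<theta> \<Longrightarrow> x \<in> carrier G \<Longrightarrow> \<theta> x \<in> carrier G"
  by (auto simp: cayley_aut_def bij_betw_def)

lemma cayley_aut_step:
  assumes "cayley_aut \<theta>" "x \<in> carrier G"
  obtains c where "bij_betw c S S" "\<forall>s\<in>S. \<theta> (s \<otimes> x) = c s \<otimes> \<theta> x"
  using assms unfolding cayley_aut_def by blast

lemma cayley_aut_conj_right:
  assumes \<theta>: "cayley_aut \<theta>" and p: "p \<in> carrier G" "q \<in> carrier G"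
  shows "cayley_aut (\<lambda>x. \<theta> (x \<otimes> p) \<otimes> q)"
  unfolding cayley_aut_def
proof (intro conjI ballI)
  have "bij_betw \<theta> (carrier G) (carrier G)" using \<theta> by (simp add: cayley_aut_def)
  from bij_betw_trans[OF bij_betw_trans[OF mult_right_bij[OF p(1)] this] mult_right_bij[OF p(2)]]
  show "bij_betw (\<lambda>x. \<theta> (x \<otimes> p) \<otimes> q) (carrier G) (carrier G)" by (simp add: comp_def)
  fix x assume x: "x \<in> carrier G"
  then have xp: "x \<otimes> p \<in> carrier G" using p by simp
  obtain c where c: "bij_betw c S S" "\<forall>s\<in>S. \<theta> (s \<otimes> (x \<otimes> p)) = c s \<otimes> \<theta> (x \<otimes> p)"
    using \<theta> xp unfolding cayley_aut_def by blast
  moreover have "c s \<in> S" if "s \<in> S" for s using that c(1) by (auto simp: bij_betw_def)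
  ultimately have "\<forall>s\<in>S. \<theta> (s \<otimes> x \<otimes> p) \<otimes> q = c s \<otimes> (\<theta> (x \<otimes> p) \<otimes> q)"
    using x p cayley_aut_closed[OF \<theta> xp] by (simp add: m_assoc)
  with c(1) show "\<exists>c. bij_betw c S S \<and> (\<forall>s\<in>S. \<theta> (s \<otimes> x \<otimes> p) \<otimes> q = c s \<otimes> (\<theta> (x \<otimes> p) \<otimes> q))"
    by blast
qed

lemma cayley_aut_inv:
  assumes \<theta>: "cayley_aut \<theta>"
  shows "cayley_aut (inv_into (carrier G) \<theta>)"
  unfolding cayley_aut_def
proof (intro conjI ballI)
  let ?i = "inv_into (carrier G) \<theta>"
  have bij: "bij_betw \<theta> (carrier G) (carrier G)" using \<theta> by (simp add: cayley_aut_def)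
  then show "bij_betw ?i (carrier G) (carrier G)" by (rule bij_betw_inv_into)
  fix y assume y: "y \<in> carrier G"
  have x: "?i y \<in> carrier G" "\<theta> (?i y) = y"
    using y bij by (auto simp: bij_betw_def inv_into_into f_inv_into_f)
  then obtain c where c: "bij_betw c S S" "\<forall>s\<in>S. \<theta> (s \<otimes> ?i y) = c s \<otimes> \<theta> (?i y)"
    using \<theta> unfolding cayley_aut_def by blast
  have "?i (t \<otimes> y) = inv_into S c t \<otimes> ?i y" if t: "t \<in> S" for t
  proof -
    have t': "inv_into S c t \<in> S" "c (inv_into S c t) = t"
      using t c(1) by (auto simp: bij_betw_def inv_into_into f_inv_into_f)
    then have "\<theta> (inv_into S c t \<otimes> ?i y) = t \<otimes> y" using c(2) x by auto
    moreover have "inv_into S c t \<otimes> ?i y \<in> carrier G" using t' x by simp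
    ultimately show ?thesis using bij by (metis bij_betw_def inv_into_f_f)
  qed
  with bij_betw_inv_into[OF c(1)]
  show "\<exists>c. bij_betw c S S \<and> (\<forall>s\<in>S. ?i (s \<otimes> y) = c s \<otimes> ?i y)" by blast
qed

lemma cayley_aut_word:
  assumes \<theta>: "cayley_aut \<theta>" "\<theta> \<one> = \<one>" and w: "w \<in> lists S"
  shows "\<exists>w'\<in>lists S. length w' = length w \<and> \<theta> (ev w) = ev w'"
  using w
proof (induction w)
  case (Cons s w)
  from Cons.IH obtain w' where w': "w' \<in> lists S" "length w' = length w" "\<theta> (ev w) = ev w'" by blast
  obtain c where c: "bij_betw c S S" "\<forall>s\<in>S. \<theta> (s \<otimes> ev w) = c s \<otimes> \<theta> (ev w)"
    using cayley_aut_step[OF \<theta>(1) ev_closed[OF Cons.hyps(2)]] .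
  have "c s \<in> S" using c(1) Cons.hyps by (auto simp: bij_betw_def)
  then show ?case using w' c(2) Cons.hyps by (intro bexI[of _ "c s # w'"]) auto
qed (auto simp: \<theta> intro!: bexI[of _ "[]"])

lemma cayley_aut_geodesic:
  assumes \<theta>: "cayley_aut \<theta>" "\<theta> \<one> = \<one>" and w: "geodesic w"
    and w': "w' \<in> lists S" "length w' = length w" "\<theta> (ev w) = ev w'"
  shows "geodesic w'"
  unfolding geodesic_def
proof (intro conjI ballI impI)
  fix v assume v: "v \<in> lists S" "ev v = ev w'"
  let ?i = "inv_into (carrier G) \<theta>"
  have inj: "inj_on \<theta> (carrier G)" using \<theta> by (simp add: cayley_aut_def bij_betw_def)
  have "?i \<one> = \<one>" using inv_into_f_f[OF inj, of \<one>] \<theta>(2) by simp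
  then obtain u where u: "u \<in> lists S" "length u = length v" "?i (ev v) = ev u"
    using cayley_aut_word[OF cayley_aut_inv[OF \<theta>(1)] _ v(1)] by blast
  have "?i (ev v) = ev w"
    using inv_into_f_f[OF inj ev_closed[OF geodesic_lists[OF w]]] v(2) w'(3) by simp
  then show "length w' \<le> length v" using geodesic_le[OF w u(1)] u w'(2) by simp
qed (rule w')

text \<open>Bending along the wall crossed by one step of a geodesic applies \<open>\<phi>\<close> to all later steps: the
  remaining steps before and after do not cross this wall.\<close>

lemma bend_geodesic:
  assumes w: "geodesic (a @ s # b)" and \<phi>: "fixes_star s \<phi>"
  obtains \<theta> where "cayley_aut \<theta>" "\<theta> \<one> = \<one>" "\<theta> (ev (a @ s # b)) = ev (map \<phi> a @ s # b)"
proof -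
  have l: "a \<in> lists S" "s \<in> S" "b \<in> lists S" "rev b \<in> lists S"
    using geodesic_lists[OF w] by (auto simp: in_lists_conv_set)
  have \<phi>a: "map \<phi> a \<in> lists S" by (rule map_lists_closed[OF fixes_star_imp[OF \<phi>] l(1)])
  have \<phi>s: "\<phi> s = s" using \<phi> by (simp add: fixes_star_def star_def)
  let ?\<theta> = "\<lambda>x. bend s \<phi> (x \<otimes> inv (ev b)) \<otimes> ev b"
  have "\<not> crossing s (rev b)"
    using geodesic_crossing_behind geodesic_suffix[OF w] by blast
  then have "bend s \<phi> (inv (ev b)) = inv (ev b)"
    using bend_ev[OF l(2) \<phi> l(4)] l by (simp add: ev_rev)
  then have "?\<theta> \<one> = \<one>" using l by simp
  moreover have "cayley_aut ?\<theta>"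
    using l by (intro cayley_aut_conj_right bend_aut \<phi>) auto
  moreover have "crossing s (a @ [s])"
    using geodesic_crossing_first_edge geodesic_prefix[of "a @ [s]" b] w by simp
  then have "bend s \<phi> (ev (a @ [s])) = ev (map \<phi> a @ [s])"
    using bend_ev[OF l(2) \<phi>, of "a @ [s]"] l by (simp add: \<phi>s)
  then have "?\<theta> (ev (a @ s # b)) = ev (map \<phi> a @ s # b)"
    using l \<phi>a by (simp add: ev_append m_assoc)
  ultimately show thesis using that by blast
qed

text \<open>Sequences of bends along a geodesic word; a later bend may take place nearer to \<open>\<one>\<close>.\<close>

inductive bends :: "'a list \<Rightarrow> 'a list \<Rightarrow> bool" where
  bends_refl: "geodesic w \<Longrightarrow> bends w w"
| bends_step: "bends w (a @ s # b) \<Longrightarrow> fixes_star s \<phi> \<Longrightarrow> bends w (map \<phi> a @ s # b)"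

lemma bends_geodesic: "bends w w' \<Longrightarrow> geodesic w'"
proof (induction rule: bends.induct)
  case (bends_step w a s b \<phi>)
  obtain \<theta> where \<theta>: "cayley_aut \<theta>" "\<theta> \<one> = \<one>" "\<theta> (ev (a @ s # b)) = ev (map \<phi> a @ s # b)"
    using bend_geodesic[OF bends_step(3,2)] .
  have "map \<phi> a @ s # b \<in> lists S"
    using geodesic_lists[OF bends_step(3)] map_lists_closed[OF fixes_star_imp[OF bends_step(2)]]
    by auto
  then show ?case using cayley_aut_geodesic[OF \<theta>(1,2) bends_step(3) _ _ \<theta>(3)] by simp
qed

lemma bends_green:
  assumes "Im z \<noteq> 0"
  shows "bends w w' \<Longrightarrow> green z (ev w') = green z (ev w)"
proof (induction rule: bends.induct)
  case (bends_step w a s b \<phi>)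
  have g: "geodesic (a @ s # b)" by (rule bends_geodesic[OF bends_step(1)])
  obtain \<theta> where \<theta>: "cayley_aut \<theta>" "\<theta> \<one> = \<one>" "\<theta> (ev (a @ s # b)) = ev (map \<phi> a @ s # b)"
    using bend_geodesic[OF g bends_step(2)] .
  show ?case
    using green_invariant[OF assms \<theta>(1,2) ev_closed[OF geodesic_lists[OF g]]] \<theta>(3) bends_step(3)
    by simp
qed simp

lemma bends_append:
  assumes "bends a a'" "geodesic (a @ b)"
  shows "bends (a @ b) (a' @ b)"
  using assms
proof (induction rule: bends.induct)
  case (bends_step w a s c \<phi>)
  then have "bends (w @ b) (map \<phi> a @ s # (c @ b))"
    by (intro bends.bends_step) auto
  then show ?case by simp
qed (rule bends_refl)

end

section \<open>Counting the images of a geodesic\<close>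

lemma blocks_exist:
  assumes "L > 0"
  shows "\<exists>bs. concat bs = w \<and> length w div L \<le> length (filter (\<lambda>b. length b = L) bs)"
proof (induction "length w" arbitrary: w rule: less_induct)
  case less
  show ?case
  proof (cases "length w < L")
    case True
    then show ?thesis by (intro exI[of _ "[w]"]) auto
  next
    case False
    then have "length (drop L w) < length w" using assms by simp
    then obtain bs where bs: "concat bs = drop L w"
      "length (drop L w) div L \<le> length (filter (\<lambda>b. length b = L) bs)"
      using less by blast
    have "length w div L = Suc (length (drop L w) div L)"
      using False assms by (simp add: le_div_geq)
    then show ?thesis using bs False by (intro exI[of _ "take L w # bs"]) auto
  qed
qed

lemma length_filter_le_add:
  assumes "\<And>x. x \<in> set xs \<Longrightarrow> P x \<Longrightarrow> Q x \<or> R x"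
  shows "length (filter P xs) \<le> length (filter Q xs) + length (filter R xs)"
  using assms
proof (induction xs)
  case (Cons x xs)
  then have "length (filter P xs) \<le> length (filter Q xs) + length (filter R xs)" by simp
  moreover have "P x \<Longrightarrow> Q x \<or> R x" using Cons.prems by simp
  ultimately show ?case by auto
qed simp

context right_angled_coxeter
begin

text \<open>A word is flexible if a bend at one of its letters \<open>s\<close> exchanges a later letter \<open>t\<close> with a letter
  \<open>u\<close> that does not commute with \<open>t\<close>; that words are read from right to left puts \<open>s\<close> to the right of \<open>t\<close>.\<close>

definition flexible :: "'a list \<Rightarrow> bool" where
  "flexible w \<longleftrightarrow> (\<exists>c t d s e u \<phi>. w = c @ t # d @ s # e \<and> fixes_star s \<phi> \<and>
     u \<in> S \<and> \<not> commuting G t u \<and> \<phi> t = u \<and> \<phi> u = t)"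

text \<open>A bend inside the flexible block nearest to \<open>\<one>\<close> moves every word in a given set to a new one: the
  first letter among \<open>t\<close> and \<open>u\<close> after \<open>s\<close> is exchanged, and this letter is determined by the group
  element because \<open>t\<close> and \<open>u\<close> do not commute. Hence each flexible block doubles the number of images.\<close>

lemma flexible_doubling:
  assumes flex: "flexible b" and w: "geodesic (a @ b)"
    and X: "finite X" "\<And>x. x \<in> X \<Longrightarrow> bends a x" "inj_on ev X"
  obtains Y where "finite Y" "\<And>y. y \<in> Y \<Longrightarrow> bends (a @ b) y" "inj_on ev Y" "card Y = 2 * card X"
proof -
  obtain c t d s e u \<phi> where b: "b = c @ t # d @ s # e" and \<phi>: "fixes_star s \<phi>"
    and u: "u \<in> S" "\<not> commuting G t u" "\<phi> t = u" "\<phi> u = t"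
    using flex unfolding flexible_def by blast
  note aut = fixes_star_imp[OF \<phi>]
  have l: "t \<in> S" "s # e \<in> lists S" using geodesic_lists[OF w] by (auto simp: b)
  have tu: "t \<noteq> u" using u(2) by (auto simp: commuting_def)
  let ?f = "\<lambda>x. x @ b" and ?h = "\<lambda>x. map \<phi> (x @ c @ t # d) @ s # e"
  have bf: "bends (a @ b) (?f x)" if "x \<in> X" for x
    using bends_append[OF X(2)[OF that] w] .
  have bh: "bends (a @ b) (?h x)" if "x \<in> X" for x
    using bends_step[OF _ \<phi>, of "a @ b" "x @ c @ t # d" e] bf[OF that] by (simp add: b)
  have lf: "x @ c @ t # d \<in> lists S" "x \<in> lists S" if "x \<in> X" for x
    using geodesic_lists[OF bends_geodesic[OF bf[OF that]]] by (simp_all add: b)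
  have lb: "b \<in> lists S" "c @ t # d \<in> lists S" using geodesic_lists[OF w] by (simp_all add: b)
  have evf: "ev (?f x) = ev x \<otimes> ev b" "ev (?f x) = ev (x @ c @ t # d) \<otimes> ev (s # e)"
    if "x \<in> X" for x
    using lf[OF that] lb l ev_append[of x b] ev_append[of "x @ c @ t # d" "s # e"]
    by (auto simp: b)
  have evh: "ev (?h x) = ev (map \<phi> (x @ c @ t # d)) \<otimes> ev (s # e)" if "x \<in> X" for x
    by (rule ev_append[OF map_lists_closed[OF aut lf(1)[OF that]] l(2)])
  have ev_cancel: "ev v = ev w"
    if "v \<in> lists S" "w \<in> lists S" "ev v \<otimes> ev (s # e) = ev w \<otimes> ev (s # e)" for v w
    using that right_cancel[OF ev_closed[OF l(2)] ev_closed[OF that(1)] ev_closed[OF that(2)]]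
    by blast
  have injf: "inj_on (\<lambda>x. ev (?f x)) X"
  proof (rule inj_onI)
    fix x y assume xy: "x \<in> X" "y \<in> X" "ev (?f x) = ev (?f y)"
    then have "ev x = ev y" using evf(1) lf(2) lb by simp
    then show "x = y" using X(3) xy by (simp add: inj_onD)
  qed
  have injh: "inj_on (\<lambda>x. ev (?h x)) X"
  proof (rule inj_onI)
    fix x y assume xy: "x \<in> X" "y \<in> X" "ev (?h x) = ev (?h y)"
    then have "ev (map \<phi> (x @ c @ t # d)) = ev (map \<phi> (y @ c @ t # d))"
      using ev_cancel[OF map_lists_closed[OF aut lf(1)] map_lists_closed[OF aut lf(1)]]
        evh[OF xy(1)] evh[OF xy(2)] xy by metis
    then have "ev (x @ c @ t # d) = ev (y @ c @ t # d)"
      using ev_map_inj[OF aut] lf xy by blast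
    then have "ev x = ev y" using lf xy lb by (simp add: ev_append[of _ "c @ t # d"])
    then show "x = y" using X(3) xy by (simp add: inj_onD)
  qed
  let ?P = "\<lambda>x. x \<in> {t, u}"
  have ne: "ev (?f x) \<noteq> ev (?h y)" if xy: "x \<in> X" "y \<in> X" for x y
  proof
    assume "ev (?f x) = ev (?h y)"
    then have eq: "ev (x @ c @ t # d) = ev (map \<phi> (y @ c @ t # d))"
      using ev_cancel[OF lf(1)[OF xy(1)] map_lists_closed[OF aut lf(1)[OF xy(2)]]]
        evf(2)[OF xy(1)] evh[OF xy(2)] by metis
    have "geodesic (x @ c @ t # d)" "geodesic (map \<phi> (y @ c @ t # d))"
      using bends_geodesic[OF bf[OF xy(1)]] bends_geodesic[OF bh[OF xy(2)]]
        geodesic_prefix[of "x @ c @ t # d" "s # e"]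
        geodesic_prefix[of "map \<phi> (y @ c @ t # d)" "s # e"] by (simp_all add: b)
    then have "filter ?P (x @ c @ t # d) = filter ?P (map \<phi> (y @ c @ t # d))"
      by (rule geodesic_filter_unique[OF _ _ eq l(1) u(1,2)])
    moreover have "filter ?P (map \<phi> v) = map \<phi> (filter ?P v)" if "v \<in> lists S" for v
    proof -
      have "\<phi> x \<in> {t, u} \<longleftrightarrow> x \<in> {t, u}" if "x \<in> S" for x
        using diagram_automorphism_eq_iff[OF aut, of x t] diagram_automorphism_eq_iff[OF aut, of x u]
          that l(1) u by auto
      then show ?thesis
        using that unfolding filter_map comp_def
        by (intro arg_cong[where f = "map \<phi>"] filter_cong) (auto simp: in_lists_conv_set)
    qed
    ultimately have "last (filter ?P (x @ c @ t # d)) = last (map \<phi> (filter ?P (y @ c @ t # d)))"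
      using lf(1)[OF xy(2)] by metis
    moreover have "last (filter ?P (v @ c @ t # d)) = last (filter ?P (t # d))" for v
      by simp
    moreover have "last (map \<phi> (filter ?P (y @ c @ t # d))) = \<phi> (last (filter ?P (y @ c @ t # d)))"
      by (rule last_map) simp
    ultimately have fp: "last (filter ?P (t # d)) = \<phi> (last (filter ?P (t # d)))" by metis
    have "last (filter ?P (t # d)) \<in> set (filter ?P (t # d))" by (rule last_in_set) simp
    then have "last (filter ?P (t # d)) \<in> {t, u}" by auto
    with fp show False using u(3,4) tu by auto
  qed
  let ?Y = "?f ` X \<union> ?h ` X"
  have "inj_on ev (?f ` X)" "inj_on ev (?h ` X)"
    using injf injh by (auto simp: inj_on_def)
  then have inj: "inj_on ev ?Y" using ne by (fastforce simp: inj_on_def)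
  have "card ?Y = card (?f ` X) + card (?h ` X)"
  proof (rule card_Un_disjoint)
    show "?f ` X \<inter> ?h ` X = {}"
    proof (rule equals0I)
      fix y assume "y \<in> ?f ` X \<inter> ?h ` X"
      then obtain x x' where "x \<in> X" "y = ?f x" "x' \<in> X" "y = ?h x'" by blast
      then show False using ne[of x x'] by metis
    qed
  qed (use X(1) in auto)
  moreover have "card (?f ` X) = card X" "card (?h ` X) = card X"
    by (rule card_image[OF inj_on_imageI2[of ev, unfolded comp_def, OF injf]],
        rule card_image[OF inj_on_imageI2[of ev, unfolded comp_def, OF injh]])
  ultimately have "card ?Y = 2 * card X" by simp
  then show thesis using that[of ?Y] inj bf bh X(1) by blast
qed

lemma flexible_blocks_images:
  assumes "geodesic (concat bs)"
  shows "\<exists>X. finite X \<and> (\<forall>x\<in>X. bends (concat bs) x) \<and> inj_on ev X \<and>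
    card X = 2 ^ length (filter flexible bs)"
  using assms
proof (induction bs rule: rev_induct)
  case Nil
  then show ?case by (intro exI[of _ "{[]}"]) (auto intro: bends_refl)
next
  case (snoc b bs)
  have w: "geodesic (concat bs @ b)" using snoc.prems by simp
  obtain X where X: "finite X" "\<And>x. x \<in> X \<Longrightarrow> bends (concat bs) x" "inj_on ev X"
    "card X = 2 ^ length (filter flexible bs)"
    using snoc.IH geodesic_prefix[OF w] by blast
  show ?case
  proof (cases "flexible b")
    case True
    obtain Y where "finite Y" "\<And>y. y \<in> Y \<Longrightarrow> bends (concat bs @ b) y" "inj_on ev Y"
      "card Y = 2 * card X"
      using flexible_doubling[OF True w X(1-3)] by metis
    then show ?thesis using True X(4) by (intro exI[of _ Y]) auto
  next
    case False
    have inj: "inj_on (\<lambda>x. ev (x @ b)) X"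
    proof (rule inj_onI)
      fix x y assume xy: "x \<in> X" "y \<in> X" "ev (x @ b) = ev (y @ b)"
      have "x \<in> lists S" "y \<in> lists S" "b \<in> lists S"
        using xy X(2) bends_geodesic geodesic_lists geodesic_suffix[OF w] by blast+
      then have "ev x = ev y" using xy(3) by (simp add: ev_append)
      then show "x = y" using X(3) xy by (simp add: inj_onD)
    qed
    have "inj_on (\<lambda>x. x @ b) X" by (simp add: inj_on_def)
    then have "card ((\<lambda>x. x @ b) ` X) = card X" by (rule card_image)
    moreover have "inj_on ev ((\<lambda>x. x @ b) ` X)" using inj by (auto simp: inj_on_def)
    ultimately show ?thesis
      using False X bends_append[OF X(2) w] by (intro exI[of _ "(\<lambda>x. x @ b) ` X"]) auto
  qed
qed

text \<open>By the pigeonhole principle some letter occurs twice, and if it commuted with all letters in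
  between, the two occurrences would cancel.\<close>

lemma long_geodesic_noncommuting:
  assumes w: "geodesic w" and long: "card S < length w"
  obtains c t d s e where "w = c @ t # d @ s # e" "\<not> commuting G s t"
proof (rule ccontr)
  assume no: "\<not> thesis"
  note rule = that
  have comm: "commuting G s t" if "w = c @ t # d @ s # e" for c t d s e
    using rule[OF that] no by blast
  have wS: "set w \<subseteq> S" using geodesic_lists[OF w] by (simp add: lists_eq_set)
  have "\<not> distinct w"
    using long card_mono[OF finite_S wS] distinct_card[of w] by auto
  then obtain c s d e where dec: "w = c @ [s] @ d @ [s] @ e" using not_distinct_decomp by blast
  have g: "geodesic (s # d @ [s])" using w geodesic_infix[of c "s # d @ [s]" e] by (simp add: dec)
  have "s \<otimes> ev d = ev d \<otimes> s"
  proof (rule commute_ev)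
    show "s \<in> S" "d \<in> lists S" using geodesic_lists[OF g] by auto
    fix t assume "t \<in> set d"
    then obtain d1 d2 where "d = d1 @ t # d2" by (meson split_list)
    then show "s \<otimes> t = t \<otimes> s"
      using comm[of "c @ [s] @ d1" t d2 s e] by (simp add: dec commuting_def)
  qed
  with geodesic_no_return[OF g] show False by blast
qed

lemma long_geodesic_flexible:
  assumes sf: "super_flexible G S m" and w: "geodesic w" "card S < length w"
  shows "flexible w \<or> flexible (rev w)"
proof -
  obtain c t d s e where dec: "w = c @ t # d @ s # e" and st: "\<not> commuting G s t"
    using long_geodesic_noncommuting[OF w] .
  have S: "s \<in> S" "t \<in> S" using geodesic_lists[OF w(1)] by (auto simp: dec)
  obtain u \<phi> where u: "u \<in> S" "\<not> commuting G u s" "\<not> commuting G u t"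
    and \<phi>: "diagram_automorphism S m \<phi>"
      "(\<phi> s = s \<and> (\<forall>v\<in>neighbors S m s. \<phi> v = v) \<and> \<phi> t = u \<and> \<phi> u = t) \<or>
       (\<phi> t = t \<and> (\<forall>v\<in>neighbors S m t. \<phi> v = v) \<and> \<phi> s = u \<and> \<phi> u = s)"
    using sf S st unfolding super_flexible_def by blast
  have sym: "\<not> commuting G s u" "\<not> commuting G t u" using u by (auto simp: commuting_def)
  from \<phi>(2) show ?thesis
  proof
    assume "\<phi> s = s \<and> (\<forall>v\<in>neighbors S m s. \<phi> v = v) \<and> \<phi> t = u \<and> \<phi> u = t"
    then have "fixes_star s \<phi>" "\<phi> t = u" "\<phi> u = t" using \<phi>(1) by (auto simp: fixes_star_def star_def)
    then have "flexible w" using dec u(1) sym unfolding flexible_def by blast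
    then show ?thesis ..
  next
    assume "\<phi> t = t \<and> (\<forall>v\<in>neighbors S m t. \<phi> v = v) \<and> \<phi> s = u \<and> \<phi> u = s"
    then have "fixes_star t \<phi>" "\<phi> s = u" "\<phi> u = s" using \<phi>(1) by (auto simp: fixes_star_def star_def)
    moreover have "rev w = rev e @ s # rev d @ t # rev c" by (simp add: dec)
    ultimately have "flexible (rev w)" using u(1) sym unfolding flexible_def by blast
    then show ?thesis ..
  qed
qed

lemma flexible_blocks_green:
  assumes "geodesic (concat bs)"
  obtains X where "finite X" "X \<subseteq> carrier G" "card X = 2 ^ length (filter flexible bs)"
    "\<And>z x. Im z \<noteq> 0 \<Longrightarrow> x \<in> X \<Longrightarrow> green z x = green z (ev (concat bs))"
proof -
  obtain X where X: "finite X" "\<forall>x\<in>X. bends (concat bs) x" "inj_on ev X"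
    "card X = 2 ^ length (filter flexible bs)"
    using flexible_blocks_images[OF assms] by blast
  show thesis
  proof (rule that[of "ev ` X"])
    show "card (ev ` X) = 2 ^ length (filter flexible bs)" using card_image[OF X(3)] X(4) by simp
    show "ev ` X \<subseteq> carrier G" using X(2) bends_geodesic geodesic_lists ev_closed by blast
    show "green z x = green z (ev (concat bs))" if "Im z \<noteq> 0" "x \<in> ev ` X" for z x
      using that X(2) bends_green by blast
  qed (use X(1) in simp)
qed

text \<open>The two cases of super-flexibility correspond to bends that start from the two ends of the word.
  One of them occurs in at least half of the blocks, and it is enough to treat this one because the
  Green function is invariant under inversion.\<close>

lemma green_constant_on_large_set:
  assumes sf: "super_flexible G S m" and w: "geodesic w"
  obtains X j where "finite X" "X \<subseteq> carrier G" "card X = 2 ^ j" "length w div (card S + 1) \<le> 2 * j"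
    "\<And>z x. Im z \<noteq> 0 \<Longrightarrow> x \<in> X \<Longrightarrow> green z x = green z (ev w)"
proof -
  let ?L = "card S + 1"
  obtain bs where bs: "concat bs = w" "length w div ?L \<le> length (filter (\<lambda>b. length b = ?L) bs)"
    using blocks_exist[of ?L w] by auto
  let ?rbs = "map rev (rev bs)"
  have rbs: "concat ?rbs = rev w" by (simp add: bs(1)[symmetric] rev_concat)
  define i j where "i = length (filter flexible bs)" and "j = length (filter flexible ?rbs)"
  have j_alt: "j = length (filter (\<lambda>b. flexible (rev b)) bs)"
    by (simp add: j_def filter_map comp_def flip: rev_filter)
  have "flexible b \<or> flexible (rev b)" if b: "b \<in> set bs" "length b = ?L" for b
  proof -
    obtain xs ys where "bs = xs @ b # ys" using b(1) by (meson split_list)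
    then have "w = concat xs @ b @ concat ys" using bs(1) by auto
    then have "geodesic b" using w geodesic_infix by blast
    then show ?thesis using long_geodesic_flexible[OF sf] b(2) by simp
  qed
  then have "length (filter (\<lambda>b. length b = ?L) bs) \<le> i + j"
    unfolding i_def j_alt by (rule length_filter_le_add)
  then have ij: "length w div ?L \<le> i + j" using bs(2) by simp
  show thesis
  proof (cases "j \<le> i")
    case True
    obtain X where X: "finite X" "X \<subseteq> carrier G" "card X = 2 ^ i"
      "\<And>z x. Im z \<noteq> 0 \<Longrightarrow> x \<in> X \<Longrightarrow> green z x = green z (ev w)"
      using flexible_blocks_green[of bs] w unfolding bs(1) i_def by blast
    show thesis by (rule that[OF X(1-3)]) (use ij True X(4) in auto)
  next
    case False
    obtain X where X: "finite X" "X \<subseteq> carrier G" "card X = 2 ^ j"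
      "\<And>z x. Im z \<noteq> 0 \<Longrightarrow> x \<in> X \<Longrightarrow> green z x = green z (ev (rev w))"
      using flexible_blocks_green[of ?rbs] geodesic_rev[OF w] unfolding rbs j_def by blast
    have "green z (ev (rev w)) = green z (ev w)" if "Im z \<noteq> 0" for z
      using that geodesic_lists[OF w] by (simp add: ev_rev green_inv)
    then show thesis using ij False X(4) by (intro that[OF X(1-3)]) auto
  qed
qed

end

section \<open>Decay of the Green function\<close>

lemma powr_times_power_bounded:
  fixes c q :: real
  assumes "0 < q" "q < 1"
  obtains K where "0 \<le> K" "\<And>n::nat. real n powr c * q ^ n \<le> K"
proof -
  have "(\<lambda>n::nat. real n powr c * q ^ n) \<longlonglongrightarrow> 0" using assms by real_asymp
  then have "Bseq (\<lambda>n::nat. real n powr c * q ^ n)" by (intro convergent_imp_Bseq convergentI)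
  then obtain K where "K > 0" "\<And>n. norm (real n powr c * q ^ n) \<le> K" by (auto elim: BseqE)
  then show thesis using that[of K] by (metis abs_le_D1 less_imp_le real_norm_def)
qed

context right_angled_coxeter
begin

lemma word_length_le:
  assumes "finite_generating_set G T"
  obtains M :: nat where "\<And>w. w \<in> lists S \<Longrightarrow> word_length G T (ev w) \<le> M * length w"
proof -
  have T: "T \<subseteq> carrier G" "generate G T = carrier G"
    using assms by (auto simp: finite_generating_set_def)
  have "\<forall>s\<in>S. \<exists>v. v \<in> lists (T \<times> UNIV) \<and> eval_word G v = s"
    using generate_eval_word[OF T(1)] T(2) S_closed by blast
  then obtain v where v: "\<And>s. s \<in> S \<Longrightarrow> v s \<in> lists (T \<times> UNIV)" "\<And>s. s \<in> S \<Longrightarrow> eval_word G (v s) = s"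
    by metis
  define M where "M = (\<Sum>s\<in>S. length (v s))"
  have M: "length (v s) \<le> M" if "s \<in> S" for s
    unfolding M_def by (rule member_le_sum) (use that finite_S in auto)
  have "\<exists>u\<in>lists (T \<times> UNIV). length u \<le> M * length w \<and> eval_word G u = ev w"
    if "w \<in> lists S" for w
    using that
  proof (induction w)
    case Nil
    show ?case by (intro bexI[of _ "[]"]) (auto simp: eval_word_def)
  next
    case (Cons s w)
    then obtain u where u: "u \<in> lists (T \<times> UNIV)" "length u \<le> M * length w" "eval_word G u = ev w"
      by blast
    have "eval_word G (v s @ u) = ev (s # w)"
      using eval_word_append(1)[OF T(1) v(1)[OF Cons.hyps(1)] u(1)] v(2)[OF Cons.hyps(1)] u(3) by simp
    moreover have "v s @ u \<in> lists (T \<times> UNIV)" using v(1)[OF Cons.hyps(1)] u(1) by simp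
    moreover have "length (v s @ u) \<le> M * length (s # w)" using M[OF Cons.hyps(1)] u(2) by simp
    ultimately show ?case by blast
  qed
  note short = this
  show thesis
  proof (rule that)
    fix w assume "w \<in> lists S"
    then obtain u where u: "u \<in> lists (T \<times> UNIV)" "length u \<le> M * length w" "eval_word G u = ev w"
      using short by blast
    then have "word_length G T (ev w) \<le> length u" unfolding word_length_def by (intro Least_le) auto
    with u(2) show "word_length G T (ev w) \<le> M * length w" by simp
  qed
qed

text \<open>An entry of \<open>\<Im> R\<close> is bounded by \<open>C\<^sub>0\<close>, and also by \<open>(C\<^sub>0 / (\<eta> 2\<^sup>j))\<^bsup>1/2\<^esup>\<close>, since its
  square occurs \<open>2\<^sup>j\<close> times in a sum that the Ward identity bounds by \<open>C\<^sub>0 / \<eta>\<close>. The geometric mean of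
  the two bounds beats any power of the length, at the cost of only \<open>\<eta>\<^bsup>-1/2\<^esup>\<close>.\<close>

lemma weighted_green_bound:
  fixes C0 c :: real
  assumes sf: "super_flexible G S m" and T: "finite_generating_set G T" and C0: "0 \<le> C0" and c: "0 \<le> c"
  obtains K where "0 \<le> K"
    "\<And>z g. 0 < Im z \<Longrightarrow> Im (green z \<one>) \<le> C0 \<Longrightarrow> g \<in> carrier G \<Longrightarrow>
      (Im (green z g))\<^sup>2 * real (word_length G T g) powr c \<le> K / sqrt (Im z)"
proof -
  obtain M where M: "\<And>w. w \<in> lists S \<Longrightarrow> word_length G T (ev w) \<le> M * length w"
    using word_length_le[OF T] by blast
  define L where "L = real (card S + 1)"
  have L: "L > 0" by (simp add: L_def)
  \<comment> \<open>A word of length \<open>n\<close> has about \<open>n / L\<close> blocks, at least half of which double the number of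
    images of the word or of its reversal, and the geometric mean takes the square root of this number.\<close>
  define q where "q = 2 powr (- 1 / (4 * L))"
  have q: "0 < q" "q < 1" using L by (simp_all add: q_def powr_less_one)
  obtain K0 where K0: "0 \<le> K0" "\<And>n::nat. real n powr c * q ^ n \<le> K0"
    using powr_times_power_bounded[OF q] by metis
  define K where "K = 2 * sqrt (C0 ^ 3) * real M powr c * K0"
  show thesis
  proof (rule that[of K])
    show "0 \<le> K" using C0 K0 by (simp add: K_def)
    fix z g assume z: "0 < Im z" and zC: "Im (green z \<one>) \<le> C0" and g: "g \<in> carrier G"
    have z0: "Im z \<noteq> 0" using z by simp
    obtain w where w: "geodesic w" "ev w = g" using geodesic_exists[OF g] .
    obtain X j where X: "finite X" "X \<subseteq> carrier G" "card X = 2 ^ j"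
      "length w div (card S + 1) \<le> 2 * j" "\<And>x. x \<in> X \<Longrightarrow> green z x = green z g"
      using green_constant_on_large_set[OF sf w(1)] z0 w(2) by metis
    define n where "n = length w"
    define f where "f = Im (green z g)"
    have f2: "f\<^sup>2 \<le> C0\<^sup>2"
    proof -
      have "\<bar>f\<bar> \<le> C0" unfolding f_def using abs_Im_green_le[OF z g] zC by linarith
      then show ?thesis using power_mono[of "\<bar>f\<bar>" C0 2] by simp
    qed
    have "2 ^ j * f\<^sup>2 \<le> (\<Sum>x\<in>X. (cmod (green z x))\<^sup>2)"
    proof -
      have "f\<^sup>2 \<le> (cmod (green z g))\<^sup>2" by (simp add: f_def cmod_power2)
      then show ?thesis using X(3,5) by simp
    qed
    also have "\<dots> \<le> sqnorm (carrier G) (green z)"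
      by (rule sum_le_sqnorm[OF green_ell2[OF z0] X(1,2)])
    also have "\<dots> \<le> C0 / Im z"
      using ward_identity[OF z0] zC z by (simp add: field_simps)
    finally have "f\<^sup>2 \<le> C0 / Im z / 2 ^ j" by (subst pos_le_divide_eq) (simp_all add: mult.commute)
    then have "f\<^sup>2 * f\<^sup>2 \<le> C0\<^sup>2 * (C0 / Im z / 2 ^ j)"
      using f2 by (intro mult_mono) auto
    then have "(f\<^sup>2)\<^sup>2 \<le> C0 ^ 3 / Im z / 2 ^ j"
      by (simp add: power2_eq_square power3_eq_cube)
    then have "f\<^sup>2 \<le> sqrt (C0 ^ 3 / Im z / 2 ^ j)" by (rule real_le_rsqrt)
    also have "\<dots> = sqrt (C0 ^ 3) / sqrt (Im z) * (1 / sqrt (2 ^ j))"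
      by (simp only: real_sqrt_divide) simp
    finally have fj: "f\<^sup>2 \<le> sqrt (C0 ^ 3) / sqrt (Im z) * (1 / sqrt (2 ^ j))" .
    have "1 / sqrt (2 ^ j) \<le> 2 * q ^ n"
    proof -
      have "n < (card S + 1) * (n div (card S + 1) + 1)"
        using dividend_less_times_div[of "card S + 1" n] by simp
      also have "\<dots> \<le> (card S + 1) * (2 * j + 1)"
        using X(4) unfolding n_def by (intro mult_le_mono) auto
      finally have "real n \<le> real ((card S + 1) * (2 * j + 1))" by linarith
      then have "real n \<le> L * (2 * real j + 1)" by (simp add: L_def algebra_simps)
      then have "real n / (4 * L) \<le> (2 * real j + 1) / 4" using L by (simp add: field_simps)
      then have "- (real j / 2) \<le> 1 + real n * (- 1 / (4 * L))" by simp
      then have "2 powr (- (real j / 2)) \<le> 2 powr (1 + real n * (- 1 / (4 * L)))"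
        by (rule powr_mono) simp
      also have "\<dots> = 2 * q ^ n"
        unfolding q_def powr_add by (simp add: powr_powr flip: powr_realpow)
      also have "2 powr (- (real j / 2)) = 1 / sqrt (2 ^ j)"
        by (simp add: powr_minus_divide powr_half_sqrt[symmetric] powr_realpow[symmetric] powr_powr)
      finally show ?thesis .
    qed
    then have "sqrt (C0 ^ 3) / sqrt (Im z) * (1 / sqrt (2 ^ j))
        \<le> sqrt (C0 ^ 3) / sqrt (Im z) * (2 * q ^ n)"
      by (rule mult_left_mono) (use C0 z in simp)
    with fj have fq: "f\<^sup>2 \<le> sqrt (C0 ^ 3) / sqrt (Im z) * (2 * q ^ n)" by (rule order_trans)
    have "real (word_length G T g) \<le> real (M * n)"
      using M[OF geodesic_lists[OF w(1)]] w(2) by (simp add: n_def flip: of_nat_mult)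
    then have "real (word_length G T g) powr c \<le> real (M * n) powr c"
      using c by (intro powr_mono2) auto
    also have "\<dots> = real M powr c * real n powr c" by (simp add: powr_mult)
    finally have "f\<^sup>2 * real (word_length G T g) powr c
        \<le> sqrt (C0 ^ 3) / sqrt (Im z) * (2 * q ^ n) * (real M powr c * real n powr c)"
      using fq C0 z q by (intro mult_mono) auto
    also have "\<dots> = 2 * sqrt (C0 ^ 3) * real M powr c / sqrt (Im z) * (real n powr c * q ^ n)"
      by simp
    also have "\<dots> \<le> 2 * sqrt (C0 ^ 3) * real M powr c / sqrt (Im z) * K0"
      using C0 z by (intro mult_left_mono K0) auto
    finally show "(Im (green z g))\<^sup>2 * real (word_length G T g) powr c \<le> K / sqrt (Im z)"
      by (simp add: f_def K_def)
  qed
qed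

end

theorem proposition6p12:
  fixes G :: "('a, 'b) monoid_scheme"
    and S T :: "'a set"
    and m :: "'a \<Rightarrow> 'a \<Rightarrow> enat"
    and I0 :: "real set"
    and P :: "'a oper"
    and R :: "complex \<Rightarrow> 'a oper"
    and C0 C1 :: real
  assumes "right_angled_coxeter_group G S m"
    and "super_flexible G S m"
    and "finite_generating_set G T"
    and "rapid_decay_exponent G C1"
    and "closed I0" and "is_interval I0" and "I0 \<noteq> {}"
    and "P = left_regular_fun G (indicator S)"
    and "R = resolvent_op (carrier G) P"
    and "\<And>E \<eta>. E \<in> I0 \<Longrightarrow> \<eta> > 0 \<Longrightarrow>
           Re (op_kernel (carrier G) (Im_op (carrier G) (R (Complex E \<eta>))) \<one>\<^bsub>G\<^esub> \<one>\<^bsub>G\<^esub>) \<le> C0"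
  shows "\<exists>C1' > 2 * C1 + 1.
    ((\<lambda>\<eta>. SUP E\<in>I0. \<Sum>\<^sub>\<infinity>g\<in>carrier G.
        ennreal (\<eta>\<^sup>2 * cmod (op_kernel (carrier G) (Im_op (carrier G) (R (Complex E \<eta>))) \<one>\<^bsub>G\<^esub> g) ^ 4
                 * real (word_length G T g) powr C1'))
      \<longlongrightarrow> 0) (at_right 0)"
proof -
  interpret right_angled_coxeter G S m by unfold_locales (rule assms(1))
  have R: "R = resolvent" by (simp add: assms(8,9) left_regular_fun_eq_adjacency)
  have kernel: "op_kernel (carrier G) (Im_op (carrier G) (R (Complex E \<eta>))) \<one>\<^bsub>G\<^esub> g
      = of_real (Im (green (Complex E \<eta>) g))" if "\<eta> > 0" "g \<in> carrier G" for E \<eta> g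
    unfolding R by (rule op_kernel_Im_resolvent) (use that in auto)
  have bound: "Im (green (Complex E \<eta>) \<one>\<^bsub>G\<^esub>) \<le> C0" if "E \<in> I0" "\<eta> > 0" for E \<eta>
    using assms(10)[OF that] kernel[OF that(2) one_closed] by simp
  have C0: "0 \<le> C0"
  proof -
    obtain E where "E \<in> I0" using assms(7) by blast
    then have "\<bar>Im (green (Complex E 1) \<one>\<^bsub>G\<^esub>)\<bar> \<le> C0"
      using abs_Im_green_le[of "Complex E 1" "\<one>\<^bsub>G\<^esub>"] bound[of E 1] by simp
    then show ?thesis by linarith
  qed
  define c where "c = 2 * C1 + 2"
  have c: "0 \<le> c" using assms(4) by (simp add: c_def rapid_decay_exponent_def)
  obtain K where K: "0 \<le> K"
    "\<And>z g. 0 < Im z \<Longrightarrow> Im (green z \<one>\<^bsub>G\<^esub>) \<le> C0 \<Longrightarrow> g \<in> carrier G \<Longrightarrow>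
      (Im (green z g))\<^sup>2 * real (word_length G T g) powr c \<le> K / sqrt (Im z)"
    using weighted_green_bound[OF assms(2,3) C0 c] by blast
  let ?F = "\<lambda>\<eta>. SUP E\<in>I0. \<Sum>\<^sub>\<infinity>g\<in>carrier G.
    ennreal (\<eta>\<^sup>2 * cmod (op_kernel (carrier G) (Im_op (carrier G) (R (Complex E \<eta>))) \<one>\<^bsub>G\<^esub> g) ^ 4
             * real (word_length G T g) powr c)"
  have F_le: "?F \<eta> \<le> ennreal (C0 * K * sqrt \<eta>)" if \<eta>: "\<eta> > 0" for \<eta>
  proof (intro SUP_least infsum_le_finite_sums nonneg_summable_on_complete zero_le)
    fix E F assume E: "E \<in> I0" and F: "finite F" "F \<subseteq> carrier G"
    define z where "z = Complex E \<eta>"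
    have z: "Im z = \<eta>" "Im z \<noteq> 0" using \<eta> by (simp_all add: z_def)
    have zC: "Im (green z \<one>\<^bsub>G\<^esub>) \<le> C0" using bound[OF E \<eta>] by (simp add: z_def)
    let ?t = "\<lambda>g. \<eta>\<^sup>2 * cmod (op_kernel (carrier G) (Im_op (carrier G) (R z)) \<one>\<^bsub>G\<^esub> g) ^ 4
             * real (word_length G T g) powr c"
    have t: "?t g \<le> \<eta>\<^sup>2 * (K / sqrt \<eta>) * (cmod (green z g))\<^sup>2" if g: "g \<in> F" for g
    proof -
      let ?f = "Im (green z g)"
      have gG: "g \<in> carrier G" using g F(2) by auto
      have "?t g = \<eta>\<^sup>2 * (?f\<^sup>2 * (?f\<^sup>2 * real (word_length G T g) powr c))"
        using kernel[OF \<eta> gG, of E] by (simp add: z_def power4_eq_xxxx power2_eq_square mult.assoc)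
      also have "\<dots> \<le> \<eta>\<^sup>2 * ((cmod (green z g))\<^sup>2 * (K / sqrt \<eta>))"
        using K(2)[OF _ zC gG] z \<eta> by (intro mult_left_mono mult_mono) (auto simp: cmod_power2)
      finally show ?thesis by (simp add: mult_ac)
    qed
    have "(\<Sum>g\<in>F. ennreal (?t g)) = ennreal (\<Sum>g\<in>F. ?t g)"
      by (rule sum_ennreal) simp
    also have "\<dots> \<le> ennreal (C0 * K * sqrt \<eta>)"
    proof (rule ennreal_leI)
      have "(\<Sum>g\<in>F. ?t g) \<le> \<eta>\<^sup>2 * (K / sqrt \<eta>) * (\<Sum>g\<in>F. (cmod (green z g))\<^sup>2)"
        unfolding sum_distrib_left by (rule sum_mono[OF t])
      also have "\<dots> \<le> \<eta>\<^sup>2 * (K / sqrt \<eta>) * (C0 / \<eta>)"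
      proof (rule mult_left_mono)
        have "(\<Sum>g\<in>F. (cmod (green z g))\<^sup>2) \<le> sqnorm (carrier G) (green z)"
          by (rule sum_le_sqnorm[OF green_ell2[OF z(2)] F])
        also have "\<dots> \<le> C0 / \<eta>"
          using ward_identity[OF z(2)] zC \<eta> unfolding z(1) by (simp add: field_simps)
        finally show "(\<Sum>g\<in>F. (cmod (green z g))\<^sup>2) \<le> C0 / \<eta>" .
      qed (use K(1) \<eta> in simp)
      also have "\<dots> = C0 * K * (\<eta> / sqrt \<eta>)" using \<eta> by (simp add: power2_eq_square)
      also have "\<eta> / sqrt \<eta> = sqrt \<eta>" using \<eta> by (simp add: real_div_sqrt)
      finally show "(\<Sum>g\<in>F. ?t g) \<le> C0 * K * sqrt \<eta>" .
    qed
    finally show "(\<Sum>g\<in>F. ennreal (\<eta>\<^sup>2 *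
        cmod (op_kernel (carrier G) (Im_op (carrier G) (R (Complex E \<eta>))) \<one>\<^bsub>G\<^esub> g) ^ 4 *
        real (word_length G T g) powr c)) \<le> ennreal (C0 * K * sqrt \<eta>)"
      by (simp add: z_def)
  qed
  have "((\<lambda>\<eta>. C0 * K * sqrt \<eta>) \<longlongrightarrow> C0 * K * sqrt 0) (at_right 0)"
    by (intro tendsto_intros)
  then have "((\<lambda>\<eta>. ennreal (C0 * K * sqrt \<eta>)) \<longlongrightarrow> ennreal 0) (at_right 0)"
    by (intro tendsto_ennrealI) simp
  then have "((\<lambda>\<eta>. ennreal (C0 * K * sqrt \<eta>)) \<longlongrightarrow> 0) (at_right 0)" by simp
  moreover have "eventually (\<lambda>\<eta>. ?F \<eta> \<le> ennreal (C0 * K * sqrt \<eta>)) (at_right 0)"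
    using eventually_at_right_less[of "0::real"] by (rule eventually_mono) (rule F_le)
  ultimately have "(?F \<longlongrightarrow> 0) (at_right 0)"
    using tendsto_sandwich[of "\<lambda>_. 0" ?F "at_right 0", OF _ _ tendsto_const] by simp
  moreover have "c > 2 * C1 + 1" by (simp add: c_def)
  ultimately show ?thesis by blast
qed

end
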